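(* Let $p,q\ge1$, $d_j,\rho_j>0$ ($1\le j\le q$), and $\xi_1,\dots,\xi_p\in\mathbb R$ with $\xi_i+\rho_j>0$ for all $i,j$. Let $\boldsymbol n\in\mathbb N_0^p$, $\boldsymbol m\in\mathbb N_0^q$ with $|\boldsymbol n|=|\boldsymbol m|=N$, and suppose $\boldsymbol m$ is near the diagonal, i.e. $|m_i-m_j|\le1$ for all $i,j$. Let $$\mathscr M^{\mathrm{LII}}_{\boldsymbol m,\boldsymbol n}=\left[\int_0^\infty y^{k+\ell}F_j(y)\mathrm e^{-\xi_iy}\,\mathrm dy\right]_{(j,k),(i,\ell)},$$ with row indices $(j,k)$, $1\le j\le q$, $0\le k<m_j$, and column indices $(i,\ell)$, $1\le i\le p$, $0\le\ell<n_i$, both ordered lexicographically. Then $$\det\mathscr M^{\mathrm{LII}}_{\boldsymbol m,\boldsymbol n}=(-1)^{\sum_j\binom{m_j}2+\sum_i\binom{n_i}2}\Bigl[\prod_j\prod_{k=0}^{m_j-1}(d_j+1)_k\Bigr]\Bigl[\prod_{j<h}(\rho_h-\rho_j)^{m_jm_h}\Bigr]\Bigl[\prod_i\prod_{\ell=0}^{n_i-1}\ell!\Bigr]\Bigl[\prod_{i<r}(\xi_r-\xi_i)^{n_in_r}\Bigr]\prod_{i=1}^p\prod_{j=1}^q(\xi_i+\rho_j)^{-(d_j+m_j)n_i}.$$ In particular, it is nonzero when the rates $\rho_j$ with $m_j>0$ are pairwise distinct and the column nodes $\xi_i$ with $n_i>0$ are pairwise distinct (and $\xi_i+\rho_j>0$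 for all $i,j$).
   Context: $(a)_k=a(a+1)\cdots(a+k-1)$, $(a)_0=1$; $|\boldsymbol m|=\sum_jm_j$; factors with exponent zero equal one. Gamma kernels $g_{\rho,d}(y)=\frac{y^{d-1}\mathrm e^{-\rho y}}{\Gamma(d)}\mathbf 1_{(0,\infty)}(y)$; additive convolution $(f*_+g)(y)=\int_0^yf(u)g(y-u)\,\mathrm du$. The rows are $F_j=g_{\rho_1,d_1+\delta_{1,j}}*_+\cdots*_+g_{\rho_q,d_q+\delta_{q,j}}$, $1\le j\le q$; equivalently $\int_0^\infty\mathrm e^{-zy}F_j(y)\,\mathrm dy=(z+\rho_j)^{-1}\prod_{h=1}^q(z+\rho_h)^{-d_h}$. *)

theory Defs
  imports "HOL-Analysis.Analysis" "Jordan_Normal_Form.Determinant"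
begin

definition gamma_kernel :: "real \<Rightarrow> real \<Rightarrow> real \<Rightarrow> real" where
  "gamma_kernel \<rho> d y = (if y > 0 then y powr (d - 1) * exp (- \<rho> * y) / Gamma d else 0)"

definition add_conv :: "(real \<Rightarrow> real) \<Rightarrow> (real \<Rightarrow> real) \<Rightarrow> real \<Rightarrow> real" where
  "add_conv f g y = (LINT u:{0..y}|lborel. f u * g (y - u))"

text \<open>All families indexed from 1 to \<open>q\<close> (or \<open>p\<close>) in the source are indexed
  from 0 to \<open>q - 1\<close> (or \<open>p - 1\<close>) here. The iterated convolution in \<open>row_fun\<close> is
  bracketed to the left; it starts with the kernel of index 0, so \<open>q \<ge> 1\<close> is intended.\<close>

definition row_fun :: "nat \<Rightarrow> (nat \<Rightarrow> real) \<Rightarrow> (nat \<Rightarrow> real) \<Rightarrow> nat \<Rightarrow> real \<Rightarrow> real" where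
  "row_fun q \<rho> d j =
     (let g = (\<lambda>h. gamma_kernel (\<rho> h) (d h + (if h = j then 1 else 0)))
      in foldl add_conv (g 0) (map g [1..<q]))"

definition lex_pairs :: "nat \<Rightarrow> (nat \<Rightarrow> nat) \<Rightarrow> (nat \<times> nat) list" where
  "lex_pairs q m = [(j, k). j \<leftarrow> [0..<q], k \<leftarrow> [0..<m j]]"

definition near_diagonal :: "nat \<Rightarrow> (nat \<Rightarrow> nat) \<Rightarrow> bool" where
  "near_diagonal q m \<longleftrightarrow> (\<forall>i<q. \<forall>j<q. \<bar>int (m i) - int (m j)\<bar> \<le> 1)"

definition M_LII ::
  "nat \<Rightarrow> nat \<Rightarrow> (nat \<Rightarrow> real) \<Rightarrow> (nat \<Rightarrow> real) \<Rightarrow> (nat \<Rightarrow> real) \<Rightarrow> (nat \<Rightarrow> nat) \<Rightarrow> (nat \<Rightarrow> nat) \<Rightarrow> real mat"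
where
  "M_LII p q d \<rho> \<xi> m n =
     Matrix.mat (\<Sum>j<q. m j) (\<Sum>i<p. n i)
       (\<lambda>(a, b).
          let (j, k) = lex_pairs q m ! a; (i, l) = lex_pairs p n ! b
          in LINT y:{0<..}|lborel. y ^ (k + l) * row_fun q \<rho> d j y * exp (- \<xi> i * y))"

end

theory Submission
  imports Defs "HOL-Computational_Algebra.Polynomial_FPS"
begin

text \<open>
  Put \<open>G(z) = \<Prod>\<^sub>h (z + \<rho>\<^sub>h)\<close> with exponents \<open>-d\<^sub>h\<close>. The entry at \<open>(j,k), (i,l)\<close> is, up to
  the sign \<open>(-1)\<close> to the power \<open>k + l\<close>, the derivative of order \<open>k + l\<close> of \<open>G(z) / (z + \<rho>\<^sub>j)\<close>
  at \<open>\<xi>\<^sub>i\<close>. Substituting \<open>z = \<xi>\<^sub>i - t\<close> absorbs the signs and turns everything into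
  power series in \<open>t\<close>, since the exponential generating function of the moments of a
  convolution is the product of those of the factors.

  For distinct rates, the \<open>k\<close>-th derivative of \<open>G(z) / (z + \<rho>\<^sub>j)\<close> equals, up to sign, \<open>G(z)\<close> times
  \<open>(d\<^sub>j + 1)\<^sub>k\<close> over the power \<open>k + 1\<close> of \<open>z + \<rho>\<^sub>j\<close>, plus terms with poles of order at most \<open>k\<close>.
  Near the diagonal every such pole occurs among the row labels, so this is
  a factorisation through a matrix that is triangular with respect to \<open>k\<close>. It leaves a
  confluent Cauchy matrix with the factor \<open>G\<close>. List the rates as \<open>r\<^sub>0, r\<^sub>1, \<dots>\<close> and the nodes as
  \<open>x\<^sub>0, x\<^sub>1, \<dots>\<close>, with multiplicity. The functions
  \<open>(\<Prod>c<b. z - x\<^sub>c) / (\<Prod>c\<le>b. z + r\<^sub>c)\<close> factor it into a lower triangular and an upper triangular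
  matrix. If two rates of positive multiplicity coincide, two rows are equal and both sides
  vanish.
\<close>

section \<open>Moments of convolutions of gamma kernels\<close>

text \<open>The series \<open>\<Phi>\<close> is the exponential generating function of the moments
  weighted by \<open>exp (- \<xi> * y)\<close>, that is, formally the Laplace transform at
  \<open>\<xi> - t\<close> expanded in \<open>t\<close>. Vanishing for \<open>y \<le> 0\<close> lets
  the convolution over \<open>{0..y}\<close> be read as one over the whole line.\<close>

definition has_moments :: "real \<Rightarrow> (real \<Rightarrow> real) \<Rightarrow> real fps \<Rightarrow> bool" where
  "has_moments \<xi> f \<Phi> \<longleftrightarrow> f \<in> borel_measurable borel \<and> (\<forall>y\<le>0. f y = 0) \<and>
     (\<forall>s. has_bochner_integral lborel (\<lambda>y. y ^ s * f y * exp (- \<xi> * y)) (fact s * fps_nth \<Phi> s))"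

text \<open>The expansion of \<open>(c - t)\<close> to the power \<open>-d\<close> in \<open>t\<close>.\<close>

definition kernel_fps :: "real \<Rightarrow> real \<Rightarrow> real fps" where
  "kernel_fps c d = Abs_fps (\<lambda>s. pochhammer d s * c powr (- d - real s) / fact s)"

text \<open>Euler's integral for \<open>Gamma s\<close> under the substitution of
  \<open>c * t\<close> for \<open>t\<close>.\<close>

lemma has_bochner_integral_Gamma:
  fixes s c :: real
  assumes "s > 0" "c > 0"
  shows "has_bochner_integral lborel
           (\<lambda>y. if y > 0 then y powr (s - 1) * exp (- c * y) else 0) (Gamma s * c powr - s)"
proof -
  have "has_bochner_integral lborel (\<lambda>t. indicator {0..} t * t powr (s - 1) / exp t) (Gamma s)"
    using Gamma_conv_nn_integral_real[OF assms(1)] Gamma_real_pos[OF assms(1)]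
    by (intro has_bochner_integral_nn_integral) auto
  hence "has_bochner_integral lborel
           (\<lambda>t. indicator {0..} (0 + c * t) * (0 + c * t) powr (s - 1) / exp (0 + c * t)) (Gamma s /\<^sub>R \<bar>c\<bar>)"
    using assms by (subst (asm) lborel_has_bochner_integral_real_affine_iff[of c _ _ 0]) auto
  \<comment> \<open>The factor \<open>c powr (1 - s)\<close> cancels the power of \<open>c\<close>
    contained in \<open>(c * t) powr (s - 1)\<close>.\<close>
  hence "has_bochner_integral lborel
           (\<lambda>t. c powr (1 - s) * (indicator {0..} (0 + c * t) * (0 + c * t) powr (s - 1) / exp (0 + c * t)))
           (c powr (1 - s) * (Gamma s /\<^sub>R \<bar>c\<bar>))"
    by (rule has_bochner_integral_mult_right)
  moreover have "c powr (1 - s) * (Gamma s /\<^sub>R \<bar>c\<bar>) = Gamma s * c powr - s"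
  proof -
    have "c powr (1 - s) = c * c powr (- s)"
      using assms powr_add[of c 1 "- s"] by simp
    thus ?thesis using assms by (simp add: field_simps)
  qed
  moreover have "c powr (1 - s) * (indicator {0..} (0 + c * t) * (0 + c * t) powr (s - 1) / exp (0 + c * t))
      = (if t > 0 then t powr (s - 1) * exp (- c * t) else 0)" for t
  \<comment> \<open>At \<open>t = 0\<close> the two integrands agree because
    \<open>0 powr (s - 1) = 0\<close>.\<close>
  proof -
    consider "t > 0" | "t = 0" | "t < 0" by linarith
    thus ?thesis
    proof cases
      case 1
      have "c powr (1 - s) * c powr (s - 1) = 1"
        using assms by (simp flip: powr_add)
      thus ?thesis using 1 assms by (simp add: powr_mult exp_minus field_simps)
    qed (use assms in \<open>auto simp: indicator_def mult_le_0_iff zero_le_mult_iff\<close>)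
  qed
  ultimately show ?thesis by (simp only:)
qed

text \<open>The factor \<open>y ^ s\<close> raises the shape parameter from \<open>d\<close> to
  \<open>d + s\<close>, and \<open>Gamma (d + s) / Gamma d\<close> is
  \<open>pochhammer d s\<close>.\<close>

lemma has_moments_gamma_kernel:
  assumes "d > 0" "\<xi> + \<rho> > 0"
  shows "has_moments \<xi> (gamma_kernel \<rho> d) (kernel_fps (\<xi> + \<rho>) d)"
  unfolding has_moments_def
proof (intro conjI allI impI)
  show "gamma_kernel \<rho> d \<in> borel_measurable borel"
    unfolding gamma_kernel_def by measurable
  fix s :: nat
  have "has_bochner_integral lborel
      (\<lambda>y. (if y > 0 then y powr (d + s - 1) * exp (- (\<xi> + \<rho>) * y) else 0) / Gamma d)
      (Gamma (d + s) * (\<xi> + \<rho>) powr - (d + s) / Gamma d)"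
    using assms by (intro has_bochner_integral_divide has_bochner_integral_Gamma) auto
  moreover have "Gamma (d + s) * (\<xi> + \<rho>) powr - (d + s) / Gamma d
      = fact s * fps_nth (kernel_fps (\<xi> + \<rho>) d) s"
  proof -
    have "d \<notin> \<int>\<^sub>\<le>\<^sub>0" using assms by (auto elim!: nonpos_Ints_cases)
    from pochhammer_Gamma[OF this] show ?thesis by (simp add: kernel_fps_def)
  qed
  moreover have "(if y > 0 then y powr (d + s - 1) * exp (- (\<xi> + \<rho>) * y) else 0) / Gamma d
      = y ^ s * gamma_kernel \<rho> d y * exp (- \<xi> * y)" for y
  proof (cases "y > 0")
    case True
    have "y powr (d + s - 1) = y ^ s * y powr (d - 1)"
      using True by (simp flip: powr_realpow powr_add add: algebra_simps)
    moreover have "exp (- (\<xi> + \<rho>) * y) = exp (- \<rho> * y) * exp (- \<xi> * y)"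
      by (simp flip: exp_add add: algebra_simps)
    ultimately show ?thesis using True by (simp add: gamma_kernel_def)
  qed (simp add: gamma_kernel_def)
  ultimately show "has_bochner_integral lborel (\<lambda>y. y ^ s * gamma_kernel \<rho> d y * exp (- \<xi> * y))
      (fact s * fps_nth (kernel_fps (\<xi> + \<rho>) d) s)" by simp
qed (simp add: gamma_kernel_def)

text \<open>Integrating over \<open>y\<close> first separates the two factors. The result is stated
  on the product space so that it can also be integrated over \<open>u\<close> first, which produces
  the convolution.\<close>

lemma has_bochner_integral_convolution:
  fixes f g :: "real \<Rightarrow> real"
  assumes f: "has_bochner_integral lborel f I" and g: "has_bochner_integral lborel g J"
  shows "integrable (lborel \<Otimes>\<^sub>M lborel) (\<lambda>(u, y). f u * g (y - u))"
    and "(LINT (u, y)|(lborel \<Otimes>\<^sub>M lborel). f u * g (y - u)) = I * J"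
proof -
  have [measurable]: "f \<in> borel_measurable borel" "g \<in> borel_measurable borel"
    using f g borel_measurable_has_bochner_integral by (auto simp: measurable_lborel1)
  have shift: "has_bochner_integral lborel (\<lambda>y. h (y - u)) K"
    if "has_bochner_integral lborel h K" for h :: "real \<Rightarrow> real" and K u
    using that lborel_has_bochner_integral_real_affine_iff[of 1 h K "- u"] by simp
  have norm_g: "has_bochner_integral lborel (\<lambda>y. \<bar>g y\<bar>) (LINT y|lborel. \<bar>g y\<bar>)"
    using g by (auto simp: has_bochner_integral_iff)
  show int: "integrable (lborel \<Otimes>\<^sub>M lborel) (\<lambda>(u, y). f u * g (y - u))"
  proof (rule lborel_pair.Fubini_integrable)
    show "AE u in lborel. integrable lborel (\<lambda>y. case (u, y) of (u, y) \<Rightarrow> f u * g (y - u))"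
      using shift[OF g] by (auto simp: has_bochner_integral_iff)
    have "(LINT y|lborel. norm (f u * g (y - u))) = \<bar>f u\<bar> * (LINT y|lborel. \<bar>g y\<bar>)" for u
      using shift[OF norm_g, of u] by (simp add: has_bochner_integral_iff abs_mult)
    thus "integrable lborel (\<lambda>u. LINT y|lborel. norm (case (u, y) of (u, y) \<Rightarrow> f u * g (y - u)))"
      using f by (simp add: has_bochner_integral_iff)
  qed measurable
  have "(LINT (u, y)|(lborel \<Otimes>\<^sub>M lborel). f u * g (y - u)) = (LINT u|lborel. LINT y|lborel. f u * g (y - u))"
    using lborel_pair.integral_fst[OF int] by simp
  also have "\<dots> = (LINT u|lborel. f u * J)"
    using shift[OF g] by (simp add: has_bochner_integral_iff)
  also have "\<dots> = I * J"
    using f by (simp add: has_bochner_integral_iff)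
  finally show "(LINT (u, y)|(lborel \<Otimes>\<^sub>M lborel). f u * g (y - u)) = I * J" .
qed

lemma has_moments_add_conv:
  assumes f: "has_moments \<xi> f \<Phi>" and g: "has_moments \<xi> g \<Psi>"
  shows "has_moments \<xi> (add_conv f g) (\<Phi> * \<Psi>)"
  unfolding has_moments_def
proof (intro conjI allI impI)
  have [measurable]: "f \<in> borel_measurable borel" "g \<in> borel_measurable borel"
    using f g by (auto simp: has_moments_def)
  have f0: "f y = 0" and g0: "g y = 0" if "y \<le> 0" for y
    using f g that by (auto simp: has_moments_def)
  have conv: "add_conv f g y = (LINT u|lborel. f u * g (y - u))" for y
    unfolding add_conv_def set_lebesgue_integral_def
  proof (rule Bochner_Integration.integral_cong)
    fix u
    show "indicator {0..y} u *\<^sub>R (f u * g (y - u)) = f u * g (y - u)"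
      using f0[of u] g0[of "y - u"] by (cases "u < 0"; cases "u > y") auto
  qed simp
  show "add_conv f g \<in> borel_measurable borel"
    unfolding conv by measurable
  show "add_conv f g y = 0" if "y \<le> 0" for y
  proof -
    have "f u * g (y - u) = 0" for u
      using f0[of u] g0[of "y - u"] that by (cases "u \<le> 0") auto
    thus ?thesis by (simp only: conv) simp
  qed
  fix s :: nat
  define F where "F a u = u ^ a * f u * exp (- \<xi> * u)" for a u
  define K where "K a u = u ^ a * g u * exp (- \<xi> * u)" for a u
  have F: "has_bochner_integral lborel (F a) (fact a * fps_nth \<Phi> a)"
    and K: "has_bochner_integral lborel (K a) (fact a * fps_nth \<Psi> a)" for a
    using f g unfolding F_def K_def has_moments_def by auto
  \<comment> \<open>Binomial expansion of \<open>y = u + (y - u)\<close> to the power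
    \<open>s\<close>; the exponential splits in the same way, so each term is a product of a
    weighted \<open>f\<close> and a shifted weighted \<open>g\<close>.\<close>
  define H where "H = (\<lambda>(u, y). \<Sum>a\<le>s. real (s choose a) * (F a u * K (s - a) (y - u)))"
  note conv_FK = has_bochner_integral_convolution[OF F K]
  have H_eq: "H (u, y) = y ^ s * exp (- \<xi> * y) * (f u * g (y - u))" for u y
  proof -
    have "y ^ s = (\<Sum>a\<le>s. real (s choose a) * u ^ a * (y - u) ^ (s - a))"
      using binomial_ring[of u "y - u" s] by simp
    moreover have "exp (- \<xi> * y) = exp (- \<xi> * u) * exp (- \<xi> * (y - u))"
      by (simp flip: exp_add add: algebra_simps)
    ultimately show ?thesis
      by (simp add: H_def F_def K_def sum_distrib_left sum_distrib_right mult_ac)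
  qed
  have int_H: "integrable (lborel \<Otimes>\<^sub>M lborel) H"
    using conv_FK(1) unfolding H_def
    by (auto simp: case_prod_unfold intro!: Bochner_Integration.integrable_sum)
  have "(LINT z|(lborel \<Otimes>\<^sub>M lborel). H z)
      = (\<Sum>a\<le>s. real (s choose a) * ((fact a * fps_nth \<Phi> a) * (fact (s - a) * fps_nth \<Psi> (s - a))))"
    using conv_FK unfolding H_def by (simp add: case_prod_unfold)
  \<comment> \<open>The binomial coefficient turns the two factorials into \<open>fact s\<close>,
    which leaves the Cauchy product of the two series.\<close>
  also have "\<dots> = (\<Sum>a\<le>s. fact s * (fps_nth \<Phi> a * fps_nth \<Psi> (s - a)))"
    by (intro sum.cong) (simp_all add: binomial_fact)
  also have "\<dots> = fact s * fps_nth (\<Phi> * \<Psi>) s"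
    by (simp add: fps_mult_nth sum_distrib_left atLeast0AtMost)
  finally have val: "(LINT z|(lborel \<Otimes>\<^sub>M lborel). H z) = fact s * fps_nth (\<Phi> * \<Psi>) s" .
  have inner: "(LINT u|lborel. H (u, y)) = y ^ s * add_conv f g y * exp (- \<xi> * y)" for y
    by (simp add: H_eq conv)
  have int_H': "integrable (lborel \<Otimes>\<^sub>M lborel) (\<lambda>(u, y). H (u, y))"
    using int_H by simp
  show "has_bochner_integral lborel (\<lambda>y. y ^ s * add_conv f g y * exp (- \<xi> * y))
      (fact s * fps_nth (\<Phi> * \<Psi>) s)"
    using lborel_pair.integrable_snd[OF int_H'] lborel_pair.integral_snd[OF int_H'] val
    by (simp add: has_bochner_integral_iff inner)
qed

section \<open>Moments of the row functions\<close>

lemma has_moments_foldl_add_conv: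
  assumes "has_moments \<xi> f \<Phi>" "\<And>h. h \<in> set hs \<Longrightarrow> has_moments \<xi> (g h) (\<Psi> h)"
  shows "has_moments \<xi> (foldl add_conv f (map g hs)) (\<Phi> * prod_list (map \<Psi> hs))"
  using assms
proof (induction hs arbitrary: f \<Phi>)
  case (Cons h hs)
  show ?case
    using Cons.IH[OF has_moments_add_conv[OF Cons.prems(1) Cons.prems(2)[of h]]] Cons.prems(2)
    by (simp add: mult.assoc)
qed simp

lemma has_moments_row_fun:
  assumes "q \<ge> 1" "\<And>h. h < q \<Longrightarrow> d h > 0" "\<And>h. h < q \<Longrightarrow> \<xi> + \<rho> h > 0"
  shows "has_moments \<xi> (row_fun q \<rho> d j)
           (\<Prod>h<q. kernel_fps (\<xi> + \<rho> h) (d h + (if h = j then 1 else 0)))"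
proof -
  define g where "g h = gamma_kernel (\<rho> h) (d h + (if h = j then 1 else 0))" for h
  define \<Psi> where "\<Psi> h = kernel_fps (\<xi> + \<rho> h) (d h + (if h = j then 1 else 0))" for h
  have g: "has_moments \<xi> (g h) (\<Psi> h)" if "h < q" for h
    unfolding g_def \<Psi>_def using assms that by (intro has_moments_gamma_kernel) (auto intro: add_pos_pos)
  have "has_moments \<xi> (foldl add_conv (g 0) (map g [1..<q])) (\<Psi> 0 * prod_list (map \<Psi> [1..<q]))"
    using assms(1) by (intro has_moments_foldl_add_conv g) auto
  moreover have "\<Psi> 0 * prod_list (map \<Psi> [1..<q]) = (\<Prod>h<q. \<Psi> h)"
    using assms(1) prod.distinct_set_conv_list[of "[1..<q]" \<Psi>]
    by (simp add: lessThan_atLeast0 prod.atLeast_Suc_lessThan)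
  ultimately show ?thesis
    by (simp only: row_fun_def Let_def g_def[abs_def] \<Psi>_def)
qed

lemma moment_row_fun:
  assumes "q \<ge> 1" "\<And>h. h < q \<Longrightarrow> d h > 0" "\<And>h. h < q \<Longrightarrow> \<xi> + \<rho> h > 0"
  shows "(LINT y:{0<..}|lborel. y ^ s * row_fun q \<rho> d j y * exp (- \<xi> * y))
    = fact s * fps_nth (\<Prod>h<q. kernel_fps (\<xi> + \<rho> h) (d h + (if h = j then 1 else 0))) s"
proof -
  note mom = has_moments_row_fun[of q d \<xi> \<rho> j, OF assms, unfolded has_moments_def]
  have "(LINT y:{0<..}|lborel. y ^ s * row_fun q \<rho> d j y * exp (- \<xi> * y))
      = (LINT y|lborel. y ^ s * row_fun q \<rho> d j y * exp (- \<xi> * y))"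
    unfolding set_lebesgue_integral_def
    using mom by (intro Bochner_Integration.integral_cong) (auto simp: indicator_def not_less)
  thus ?thesis
    using mom by (simp add: has_bochner_integral_iff)
qed

section \<open>Pole expansions of derivatives\<close>

abbreviation pole_fps :: "real \<Rightarrow> real fps" where
  "pole_fps c \<equiv> inverse (fps_const c - fps_X)"

text \<open>For \<open>(c - t)\<close> to the power \<open>-d\<close> these are the rules for
  multiplying by \<open>1 / (c - t)\<close> and for differentiating in \<open>t\<close>. The second
  exhibits the logarithmic derivative as a multiple of a simple pole.\<close>

lemma kernel_fps_add_1:
  assumes "c > 0"
  shows "kernel_fps c (d + 1) = kernel_fps c d * pole_fps c"
    and "fps_deriv (kernel_fps c d) = kernel_fps c d * (fps_const d * pole_fps c)"
proof -
  \<comment> \<open>All that is used about the real powers of \<open>c\<close> is the recurrence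
    \<open>c_w\<close>.\<close>
  define w where "w s = c powr (- (d + real s))" for s
  have c_w: "c * w (Suc s) = w s" for s
    using assms powr_add[of c 1 "- (d + real (Suc s))"] by (simp add: w_def algebra_simps)
  have nth: "fps_nth (kernel_fps c d) s = pochhammer d s * w s / fact s" for s
    by (simp add: kernel_fps_def w_def)
  have nth': "fps_nth (kernel_fps c (d + 1)) s = pochhammer (d + 1) s * w (Suc s) / fact s" for s
    by (simp add: kernel_fps_def w_def algebra_simps)
  have "kernel_fps c (d + 1) * (fps_const c - fps_X) = kernel_fps c d"
  proof (rule fps_ext)
    fix s
    show "fps_nth (kernel_fps c (d + 1) * (fps_const c - fps_X)) s = fps_nth (kernel_fps c d) s"
    proof (cases s)
      case 0
      thus ?thesis using c_w[of 0] by (simp add: nth nth' right_diff_distrib mult.commute)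
    next
      case (Suc a)
      \<comment> \<open>The left side is \<open>(d + 1 + a) - (a + 1) = d\<close> times
        \<open>pochhammer (d + 1) a\<close>.\<close>
      have p: "pochhammer (d + 1) (Suc a) - real (Suc a) * pochhammer (d + 1) a = pochhammer d (Suc a)"
        unfolding pochhammer_rec[of d] by (simp add: pochhammer_rec' algebra_simps)
      have "fps_nth (kernel_fps c (d + 1) * (fps_const c - fps_X)) s
          = pochhammer (d + 1) (Suc a) * (c * w (Suc (Suc a))) / fact (Suc a)
            - pochhammer (d + 1) a * w (Suc a) / fact a"
        by (simp add: nth' right_diff_distrib Suc del: fact_Suc)
      also have "\<dots> = (pochhammer (d + 1) (Suc a) - real (Suc a) * pochhammer (d + 1) a)
          * w (Suc a) / fact (Suc a)"
        unfolding c_w by (simp add: field_simps del: of_nat_Suc)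
      finally show ?thesis unfolding p by (simp add: nth Suc)
    qed
  qed
  moreover have "(fps_const c - fps_X) * pole_fps c = 1"
    using assms by (intro inverse_mult_eq_1') auto
  ultimately show *: "kernel_fps c (d + 1) = kernel_fps c d * pole_fps c"
    by (metis mult.assoc mult.right_neutral)
  have "fps_deriv (kernel_fps c d) = fps_const d * kernel_fps c (d + 1)"
  proof (rule fps_ext)
    fix s
    have "fps_nth (fps_deriv (kernel_fps c d)) s = real (Suc s) * (pochhammer d (Suc s) * w (Suc s) / fact (Suc s))"
      by (simp add: nth)
    also have "\<dots> = d * (pochhammer (d + 1) s * w (Suc s) / fact s)"
      by (simp add: pochhammer_rec field_simps del: of_nat_Suc)
    also have "\<dots> = fps_nth (fps_const d * kernel_fps c (d + 1)) s"
      by (simp add: nth')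
    finally show "fps_nth (fps_deriv (kernel_fps c d)) s = fps_nth (fps_const d * kernel_fps c (d + 1)) s" .
  qed
  thus "fps_deriv (kernel_fps c d) = kernel_fps c d * (fps_const d * pole_fps c)"
    unfolding * by (simp add: mult_ac)
qed

lemma fps_deriv_pole_fps: "c \<noteq> 0 \<Longrightarrow> fps_deriv (pole_fps c) = pole_fps c ^ 2"
  by (subst fps_inverse_deriv) auto

text \<open>Partial fractions. For \<open>a = \<xi> + \<rho> h\<close> and
  \<open>b = \<xi> + \<rho> h'\<close> the coefficient \<open>1 / (b - a)\<close> does not involve
  \<open>\<xi>\<close>.\<close>

lemma pole_fps_mult:
  assumes "a \<noteq> 0" "b \<noteq> 0" "a \<noteq> b"
  shows "pole_fps a * pole_fps b = fps_const (1 / (b - a)) * (pole_fps a - pole_fps b)"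
proof -
  have a: "(fps_const a - fps_X) * pole_fps a = 1" and b: "(fps_const b - fps_X) * pole_fps b = 1"
    using assms by (intro inverse_mult_eq_1'; simp)+
  have "pole_fps a - pole_fps b
      = pole_fps a * ((fps_const b - fps_X) * pole_fps b) - pole_fps b * ((fps_const a - fps_X) * pole_fps a)"
    unfolding a b by simp
  also have "\<dots> = fps_const (b - a) * (pole_fps a * pole_fps b)"
    by (simp add: algebra_simps flip: fps_const_sub)
  finally have "fps_const (1 / (b - a)) * (pole_fps a - pole_fps b)
      = fps_const (1 / (b - a)) * fps_const (b - a) * (pole_fps a * pole_fps b)"
    by (simp add: mult.assoc)
  thus ?thesis using assms by (simp add: fps_const_mult)
qed

lemma fps_deriv_prod_log:
  assumes "\<And>h. h \<in> H \<Longrightarrow> fps_deriv (f h) = f h * g h"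
  shows "fps_deriv (prod f H) = prod f H * sum g H"
  using assms
  by (induction H rule: infinite_finite_induct) (simp_all add: algebra_simps)

text \<open>This separates the moment order \<open>k + l\<close>: differentiating \<open>k\<close>
  times belongs to the row, extracting the coefficient of order \<open>l\<close> to the
  column.\<close>

lemma fps_nth_funpow_deriv:
  "fps_nth ((fps_deriv ^^ k) f) l * fact l = (fact (k + l) * fps_nth f (k + l) :: real)"
proof (induction k arbitrary: l)
  case (Suc k)
  show ?case using Suc[of "Suc l"] by (simp add: algebra_simps)
qed simp

section \<open>Combinations of pole powers with coefficients common to all nodes\<close>

text \<open>The coefficients do not depend on \<open>i\<close>; this is what turns expansions into matrix
  factorisations.\<close>

definition pole_span :: "'i set \<Rightarrow> nat \<Rightarrow> ('i \<Rightarrow> nat \<Rightarrow> real fps) \<Rightarrow> nat \<Rightarrow> ('i \<Rightarrow> real fps) \<Rightarrow> bool" where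
  "pole_span I q E k f \<longleftrightarrow>
     (\<exists>c. \<forall>i\<in>I. f i = (\<Sum>h<q. \<Sum>s<k. fps_const (c h s) * E i h ^ Suc s))"

lemma pole_spanI: "(\<And>i. i \<in> I \<Longrightarrow> f i = (\<Sum>h<q. \<Sum>s<k. fps_const (c h s) * E i h ^ Suc s)) \<Longrightarrow> pole_span I q E k f"
  unfolding pole_span_def by blast

lemma pole_span_cong: "pole_span I q E k f \<Longrightarrow> (\<And>i. i \<in> I \<Longrightarrow> f i = g i) \<Longrightarrow> pole_span I q E k g"
  unfolding pole_span_def by simp

lemma pole_span_add:
  assumes "pole_span I q E k f" "pole_span I q E k g"
  shows "pole_span I q E k (\<lambda>i. f i + g i)"
proof -
  obtain c c' where c: "f i = (\<Sum>h<q. \<Sum>s<k. fps_const (c h s) * E i h ^ Suc s)"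
    "g i = (\<Sum>h<q. \<Sum>s<k. fps_const (c' h s) * E i h ^ Suc s)" if "i \<in> I" for i
    using assms unfolding pole_span_def by blast
  show ?thesis
    by (rule pole_spanI[where c = "\<lambda>h s. c h s + c' h s"])
      (simp only: c sum.distrib distrib_right flip: fps_const_add)
qed

lemma pole_span_scale:
  assumes "pole_span I q E k f"
  shows "pole_span I q E k (\<lambda>i. fps_const a * f i)"
proof -
  obtain c where c: "f i = (\<Sum>h<q. \<Sum>s<k. fps_const (c h s) * E i h ^ Suc s)" if "i \<in> I" for i
    using assms unfolding pole_span_def by blast
  show ?thesis
    by (rule pole_spanI[where c = "\<lambda>h s. a * c h s"])
      (simp only: c sum_distrib_left mult.assoc flip: fps_const_mult)
qed

lemma pole_span_sum:
  assumes "\<And>a. a \<in> A \<Longrightarrow> pole_span I q E k (f a)"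
  shows "pole_span I q E k (\<lambda>i. \<Sum>a\<in>A. f a i)"
  using assms
proof (induction A rule: infinite_finite_induct)
  case (insert a A)
  thus ?case by (simp add: pole_span_add)
qed (auto intro!: pole_spanI[where c = "\<lambda>_ _. 0"])

lemma pole_span_basis:
  assumes "h < q" "s < k"
  shows "pole_span I q E k (\<lambda>i. E i h ^ Suc s)"
proof (rule pole_spanI[where c = "\<lambda>h' s'. if h' = h \<and> s' = s then 1 else 0"])
  fix i
  \<comment> \<open>The condition is nested so that each of the two sums collapses to a single term
    separately.\<close>
  have "fps_const (if h' = h \<and> s' = s then 1 else 0) * E i h' ^ Suc s'
      = (if s' = s then if h' = h then E i h ^ Suc s else 0 else 0)" for h' s'
    by simp
  hence "(\<Sum>h'<q. \<Sum>s'<k. fps_const (if h' = h \<and> s' = s then 1 else 0) * E i h' ^ Suc s')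
     = (\<Sum>h'<q. \<Sum>s'<k. if s' = s then if h' = h then E i h ^ Suc s else 0 else 0)"
    by presburger
  also have "\<dots> = E i h ^ Suc s" using assms by simp
  finally show "E i h ^ Suc s =
      (\<Sum>h'<q. \<Sum>s'<k. fps_const (if h' = h \<and> s' = s then 1 else 0) * E i h' ^ Suc s')" ..
qed

lemma pole_span_mono:
  assumes "pole_span I q E k f" "k \<le> k'"
  shows "pole_span I q E k' f"
proof -
  obtain c where c: "f i = (\<Sum>h<q. \<Sum>s<k. fps_const (c h s) * E i h ^ Suc s)" if "i \<in> I" for i
    using assms unfolding pole_span_def by blast
  have "pole_span I q E k' (\<lambda>i. \<Sum>h<q. \<Sum>s<k. fps_const (c h s) * E i h ^ Suc s)"
    using assms(2) by (intro pole_span_sum pole_span_scale pole_span_basis) auto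
  thus ?thesis by (rule pole_span_cong) (simp add: c)
qed

text \<open>The differential algebra behind the expansion: simple poles in \<open>t\<close>, a
  factor \<open>G\<close> whose logarithmic derivative is a sum of poles, and partial fractions.
  None of the scalars depends on \<open>i\<close>, so all expansions derived from these rules have
  coefficients common to all \<open>i\<close>.\<close>

locale pole_system =
  fixes I :: "'i set" and q :: nat and E :: "'i \<Rightarrow> nat \<Rightarrow> real fps"
    and G :: "'i \<Rightarrow> real fps" and d \<rho> :: "nat \<Rightarrow> real"
  assumes deriv_E: "i \<in> I \<Longrightarrow> h < q \<Longrightarrow> fps_deriv (E i h) = E i h ^ 2"
    and deriv_G: "i \<in> I \<Longrightarrow> fps_deriv (G i) = G i * (\<Sum>h<q. fps_const (d h) * E i h)"
    and E_mult: "i \<in> I \<Longrightarrow> h < q \<Longrightarrow> h' < q \<Longrightarrow> h \<noteq> h' \<Longrightarrow>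
      E i h * E i h' = fps_const (1 / (\<rho> h' - \<rho> h)) * (E i h - E i h')"
begin

text \<open>Multiplying by a different simple pole does not raise the pole order. Partial fractions
  applied to one factor \<open>E i h\<close> leave \<open>E i h ^ Suc (Suc s)\<close> and the same
  kind of product with one factor fewer.\<close>

lemma pole_span_mult_other:
  assumes "h < q" "h' < q" "h \<noteq> h'"
  shows "pole_span I q E (Suc s) (\<lambda>i. E i h ^ Suc s * E i h')"
proof (induction s)
  case 0
  have "pole_span I q E 1 (\<lambda>i. fps_const (1 / (\<rho> h' - \<rho> h)) * (E i h ^ Suc 0 + fps_const (- 1) * E i h' ^ Suc 0))"
    using assms by (intro pole_span_scale pole_span_add pole_span_basis) auto
  thus ?case
    by (rule pole_span_cong[OF pole_span_mono]) (use assms in \<open>auto simp: E_mult fps_const_neg[symmetric]\<close>)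
next
  case (Suc s)
  have "pole_span I q E (Suc (Suc s)) (\<lambda>i. fps_const (1 / (\<rho> h' - \<rho> h)) *
      (E i h ^ Suc (Suc s) + fps_const (- 1) * (E i h ^ Suc s * E i h')))"
    using assms by (intro pole_span_scale pole_span_add pole_span_basis pole_span_mono[OF Suc]) auto
  thus ?case
  proof (rule pole_span_cong)
    fix i assume i: "i \<in> I"
    have "E i h ^ Suc (Suc s) * E i h' = E i h ^ Suc s * (E i h * E i h')"
      by (simp add: mult_ac)
    thus "fps_const (1 / (\<rho> h' - \<rho> h)) * (E i h ^ Suc (Suc s) + fps_const (- 1) * (E i h ^ Suc s * E i h'))
        = E i h ^ Suc (Suc s) * E i h'"
      using i assms by (simp add: E_mult algebra_simps fps_const_neg[symmetric])
  qed
qed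

text \<open>Differentiating \<open>G i * f i\<close> and dividing by \<open>G i\<close> gives the
  derivative of \<open>f i\<close> plus \<open>f i\<close> times the logarithmic derivative. For a
  pole power the new top order arises twice, with weight \<open>Suc s\<close> from the derivative
  and \<open>d h\<close> from the matching pole of \<open>G\<close>; the other poles add nothing of
  higher order.\<close>

lemma log_deriv_basis:
  assumes "h < q"
  shows "pole_span I q E (Suc s) (\<lambda>i. fps_deriv (E i h ^ Suc s)
      + E i h ^ Suc s * (\<Sum>h'<q. fps_const (d h') * E i h')
      - fps_const (d h + real (Suc s)) * E i h ^ Suc (Suc s))"
proof (rule pole_span_cong)
  show "pole_span I q E (Suc s) (\<lambda>i. \<Sum>h'\<in>{..<q} - {h}. fps_const (d h') * (E i h ^ Suc s * E i h'))"
    using assms by (intro pole_span_sum pole_span_scale pole_span_mult_other) auto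
  fix i assume i: "i \<in> I"
  have "(\<Sum>h'<q. fps_const (d h') * E i h') = fps_const (d h) * E i h + (\<Sum>h'\<in>{..<q} - {h}. fps_const (d h') * E i h')"
    using assms by (subst sum.remove[of _ h]) auto
  moreover have "fps_deriv (E i h ^ Suc s) = fps_const (real (Suc s)) * E i h ^ Suc (Suc s)"
    using i assms by (simp only: fps_deriv_power deriv_E)
      (simp add: power2_eq_square mult_ac flip: fps_of_nat)
  ultimately show "(\<Sum>h'\<in>{..<q} - {h}. fps_const (d h') * (E i h ^ Suc s * E i h'))
      = fps_deriv (E i h ^ Suc s) + E i h ^ Suc s * (\<Sum>h'<q. fps_const (d h') * E i h')
        - fps_const (d h + real (Suc s)) * E i h ^ Suc (Suc s)"
    by (simp add: algebra_simps sum_distrib_left flip: fps_const_add del: of_nat_Suc)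
qed

lemma log_deriv_span:
  assumes "pole_span I q E k f"
  shows "pole_span I q E (Suc k) (\<lambda>i. fps_deriv (f i) + f i * (\<Sum>h<q. fps_const (d h) * E i h))"
proof -
  obtain c where c: "f i = (\<Sum>h<q. \<Sum>s<k. fps_const (c h s) * E i h ^ Suc s)" if "i \<in> I" for i
    using assms unfolding pole_span_def by blast
  let ?S = "\<lambda>i. \<Sum>h<q. fps_const (d h) * E i h"
  \<comment> \<open>The top term is subtracted and added back, so that
    \<open>log_deriv_basis\<close> covers one part and a basis element the other.\<close>
  have "pole_span I q E (Suc k) (\<lambda>i. \<Sum>h<q. \<Sum>s<k. fps_const (c h s) *
     ((fps_deriv (E i h ^ Suc s) + E i h ^ Suc s * ?S i - fps_const (d h + real (Suc s)) * E i h ^ Suc (Suc s))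
       + fps_const (d h + real (Suc s)) * E i h ^ Suc (Suc s)))"
    by (intro pole_span_sum pole_span_scale pole_span_add pole_span_mono[OF log_deriv_basis] pole_span_basis) auto
  thus ?thesis
    by (rule pole_span_cong)
      (simp add: c fps_deriv_sum sum_distrib_right sum.distrib distrib_left mult.assoc del: power_Suc fps_deriv_power)
qed

text \<open>Each differentiation multiplies the leading coefficient by the next factor
  \<open>d j + real (Suc k)\<close>, which builds up the Pochhammer symbol, while the remainder
  stays one order below the leading pole.\<close>

lemma funpow_deriv_expansion:
  assumes "j < q"
  shows "\<exists>R. pole_span I q E k R \<and> (\<forall>i\<in>I. (fps_deriv ^^ k) (G i * E i j) =
           G i * (fps_const (pochhammer (d j + 1) k) * E i j ^ Suc k + R i))"
proof (induction k)
  case 0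
  show ?case by (rule exI[of _ "\<lambda>_. 0"]) (auto intro: pole_spanI)
next
  case (Suc k)
  then obtain R where R: "pole_span I q E k R"
    "\<And>i. i \<in> I \<Longrightarrow> (fps_deriv ^^ k) (G i * E i j) =
       G i * (fps_const (pochhammer (d j + 1) k) * E i j ^ Suc k + R i)" by blast
  let ?S = "\<lambda>i. \<Sum>h<q. fps_const (d h) * E i h" and ?P = "\<lambda>k. fps_const (pochhammer (d j + 1) k)"
  \<comment> \<open>What is left after removing the new leading pole: the derivative of the old
    remainder, and the lower-order part coming from the old leading pole.\<close>
  define R' where "R' i = fps_deriv (R i) + R i * ?S i + ?P k * (fps_deriv (E i j ^ Suc k)
      + E i j ^ Suc k * ?S i - fps_const (d j + real (Suc k)) * E i j ^ Suc (Suc k))" for i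
  have "pole_span I q E (Suc k) R'"
    unfolding R'_def
    by (intro pole_span_add pole_span_scale log_deriv_basis log_deriv_span R assms)
  moreover have "(fps_deriv ^^ Suc k) (G i * E i j) = G i * (?P (Suc k) * E i j ^ Suc (Suc k) + R' i)"
    if i: "i \<in> I" for i
  proof -
    have P: "?P (Suc k) = ?P k * fps_const (d j + real (Suc k))"
      by (simp add: pochhammer_rec' algebra_simps)
    have "(fps_deriv ^^ Suc k) (G i * E i j) = fps_deriv (G i * (?P k * E i j ^ Suc k + R i))"
      using R(2)[OF i] by simp
    also have "\<dots> = G i * (?P k * fps_deriv (E i j ^ Suc k) + fps_deriv (R i)
        + ?S i * (?P k * E i j ^ Suc k + R i))"
      using deriv_G[OF i] by (simp add: algebra_simps del: power_Suc fps_deriv_power)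
    also have "\<dots> = G i * (?P (Suc k) * E i j ^ Suc (Suc k) + R' i)"
      unfolding P R'_def by (simp only: algebra_simps)
    finally show ?thesis .
  qed
  ultimately show ?case by blast
qed

end

section \<open>Lexicographic indices\<close>

lemma lex_pairs_Suc: "lex_pairs (Suc q) m = lex_pairs q m @ map (Pair q) [0..<m q]"
proof -
  have "concat (map (\<lambda>k. [(q, k)]) ks) = map (Pair q) ks" for ks :: "nat list"
    by (induction ks) auto
  thus ?thesis by (simp add: lex_pairs_def)
qed

lemma length_lex_pairs: "length (lex_pairs q m) = (\<Sum>j<q. m j)"
  by (induction q) (simp add: lex_pairs_def, simp add: lex_pairs_Suc)

lemma set_lex_pairs: "set (lex_pairs q m) = (SIGMA j:{..<q}. {..<m j})"
  by (auto simp: lex_pairs_def)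

lemma distinct_lex_pairs: "distinct (lex_pairs q m)"
proof (induction q)
  case (Suc q)
  thus ?case by (auto simp: lex_pairs_Suc set_lex_pairs distinct_map inj_on_def)
qed (simp add: lex_pairs_def)

lemma bij_betw_lex_pairs:
  "bij_betw ((!) (lex_pairs q m)) {..<\<Sum>j<q. m j} (SIGMA j:{..<q}. {..<m j})"
  using bij_betw_nth[OF distinct_lex_pairs] by (simp add: length_lex_pairs set_lex_pairs)

lemma nth_lex_pairs_prefix:
  assumes "h \<le> q" "c < (\<Sum>j<h. m j)"
  shows "lex_pairs q m ! c = lex_pairs h m ! c"
  using assms(1)
proof (induction q rule: dec_induct)
  case (step q)
  have "(\<Sum>j<h. m j) \<le> (\<Sum>j<q. m j)"
    using step.hyps by (intro sum_mono2) auto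
  thus ?case using step assms(2) by (simp add: lex_pairs_Suc nth_append length_lex_pairs)
qed simp

lemma nth_lex_pairs:
  assumes "h < q" "s < m h"
  shows "lex_pairs q m ! ((\<Sum>j<h. m j) + s) = (h, s)"
proof -
  have "lex_pairs q m ! ((\<Sum>j<h. m j) + s) = lex_pairs (Suc h) m ! ((\<Sum>j<h. m j) + s)"
    using assms by (intro nth_lex_pairs_prefix) auto
  thus ?thesis using assms by (simp add: lex_pairs_Suc nth_append length_lex_pairs)
qed

lemma lex_pairs_indexE:
  fixes m :: "nat \<Rightarrow> nat" and q :: nat
  assumes "a < (\<Sum>j<q. m j)"
  obtains h s where "h < q" "s < m h" "a = (\<Sum>j<h. m j) + s"
proof -
  have "\<exists>h s. h < q \<and> s < m h \<and> a = (\<Sum>j<h. m j) + s"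
    using assms
  proof (induction q)
    case (Suc q)
    show ?case
    proof (cases "a < (\<Sum>j<q. m j)")
      case True
      thus ?thesis using Suc.IH less_SucI by blast
    next
      case False
      thus ?thesis using Suc.prems by (intro exI[of _ q] exI[of _ "a - (\<Sum>j<q. m j)"]) auto
    qed
  qed simp
  thus ?thesis using that by blast
qed

lemma prod_lex_pairs:
  "(\<Prod>c<\<Sum>j<q. m j. f (lex_pairs q m ! c)) = (\<Prod>j<q. \<Prod>k<m j. f (j, k))"
  using prod.reindex_bij_betw[OF bij_betw_lex_pairs, of f q m] by (simp add: prod.Sigma)

text \<open>A prefix consists of complete blocks and \<open>s\<close> entries of block
  \<open>h\<close>. Allowing \<open>s = m h\<close> makes room for prefixes that end just after a
  given pair, where the length contains \<open>Suc s\<close>.\<close>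

lemma prod_lex_pairs_prefix:
  assumes "h < q" "s \<le> m h"
  shows "(\<Prod>c<(\<Sum>j<h. m j) + s. f (fst (lex_pairs q m ! c))) = (\<Prod>j<h. f j ^ m j) * f h ^ s"
  using assms(2)
proof (induction s)
  case 0
  have "(\<Prod>c<\<Sum>j<h. m j. f (fst (lex_pairs q m ! c))) = (\<Prod>c<\<Sum>j<h. m j. f (fst (lex_pairs h m ! c)))"
    using assms by (intro prod.cong) (simp_all add: nth_lex_pairs_prefix[of h q])
  also have "\<dots> = (\<Prod>j<h. f j ^ m j)"
    using prod_lex_pairs[of "\<lambda>z. f (fst z)" h m] by simp
  finally show ?case by simp
next
  case (Suc s)
  thus ?case using nth_lex_pairs[of h q s m] assms(1) by (simp add: mult_ac)
qed

section \<open>Triangular determinants\<close>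

text \<open>In the Leibniz expansion a permutation with a nonzero term never raises the rank, so it
  preserves the sum of the ranks only if it is the identity.\<close>

lemma det_rank_triangular:
  fixes A :: "'a :: comm_ring_1 mat" and r :: "nat \<Rightarrow> nat"
  assumes A: "A \<in> carrier_mat n n"
    and r: "\<And>i j. i < n \<Longrightarrow> j < n \<Longrightarrow> i \<noteq> j \<Longrightarrow> A $$ (i, j) \<noteq> 0 \<Longrightarrow> r j < r i"
  shows "Determinant.det A = (\<Prod>i<n. A $$ (i, i))"
proof -
  let ?t = "\<lambda>\<pi>. signof \<pi> * (\<Prod>i = 0..<n. A $$ (i, \<pi> i))"
  have "?t \<pi> = 0" if \<pi>: "\<pi> permutes {0..<n}" "\<pi> \<noteq> id" for \<pi>
  proof (rule ccontr)
    assume "?t \<pi> \<noteq> 0"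
    hence "(\<Prod>i = 0..<n. A $$ (i, \<pi> i)) \<noteq> 0" by auto
    hence nz: "A $$ (i, \<pi> i) \<noteq> 0" if "i < n" for i
      using that prod_zero[of "{0..<n}" "\<lambda>i. A $$ (i, \<pi> i)"] atLeastLessThan_iff by blast
    obtain i where i: "\<pi> i \<noteq> i" using \<pi>(2) by (auto simp: fun_eq_iff)
    hence "i \<in> {0..<n}" using \<pi>(1) by (meson permutes_not_in)
    have \<pi>n: "\<pi> i < n" if "i < n" for i
      using permutes_in_image[OF \<pi>(1), of i] that by simp
    have "(\<Sum>i = 0..<n. r (\<pi> i)) < (\<Sum>i = 0..<n. r i)"
    proof (rule sum_strict_mono_ex1)
      show "\<forall>i\<in>{0..<n}. r (\<pi> i) \<le> r i"
      proof
        fix i assume "i \<in> {0..<n}"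
        thus "r (\<pi> i) \<le> r i" using r[of i "\<pi> i"] nz[of i] \<pi>n[of i] by (cases "\<pi> i = i") auto
      qed
      show "\<exists>i\<in>{0..<n}. r (\<pi> i) < r i"
        using i \<open>i \<in> {0..<n}\<close> r[of i "\<pi> i"] nz[of i] \<pi>n[of i] by (intro bexI[of _ i]) auto
    qed simp
    moreover have "(\<Sum>i = 0..<n. r (\<pi> i)) = (\<Sum>i = 0..<n. r i)"
      using sum.permute[OF \<pi>(1), of r] by (simp add: o_def)
    ultimately show False by simp
  qed
  hence "(\<Sum>\<pi> | \<pi> permutes {0..<n}. ?t \<pi>) = (\<Sum>\<pi>\<in>{id}. ?t \<pi>)"
    by (intro sum.mono_neutral_right) (auto simp: finite_permutations permutes_id)
  thus ?thesis using det_def'[OF A] by (simp add: lessThan_atLeast0)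
qed

section \<open>Newton--Cauchy bases\<close>

text \<open>Every summand with \<open>b < a\<close> contains the factor \<open>z + r a\<close>, so
  evaluation at \<open>- r a\<close> determines the last coefficient. Subtracting that summand
  leaves a multiple of \<open>z + r a\<close>, and the quotient has smaller degree. The hypothesis
  on \<open>r b + x c\<close> keeps the evaluated products nonzero.\<close>

lemma newton_cauchy_expansion:
  fixes P :: "real poly" and x r :: "nat \<Rightarrow> real"
  assumes "\<And>b c. c < b \<Longrightarrow> b \<le> a \<Longrightarrow> r b + x c \<noteq> 0" "degree P \<le> a"
  shows "\<exists>\<kappa>. \<kappa> a = poly P (- r a) / (\<Prod>c<a. - r a - x c) \<and>
    P = (\<Sum>b\<le>a. Polynomial.smult (\<kappa> b) ((\<Prod>c<b. [:- x c, 1:]) * (\<Prod>c\<in>{b<..a}. [:r c, 1:])))"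
  using assms
proof (induction a arbitrary: P)
  case 0
  then obtain p where "P = [:p:]" by (auto elim: degree_eq_zeroE)
  thus ?case by (intro exI[of _ "\<lambda>_. p"]) simp
next
  case (Suc a)
  let ?r = "r (Suc a)" and ?\<omega> = "\<lambda>b. \<Prod>c<b. [:- x c, 1:]"
  \<comment> \<open>Chosen so that subtracting \<open>k\<close> times the Newton product leaves a
    polynomial vanishing at \<open>- r (Suc a)\<close>.\<close>
  define k where "k = poly P (- ?r) / (\<Prod>c<Suc a. - ?r - x c)"
  have "(\<Prod>c<Suc a. - ?r - x c) \<noteq> 0"
  proof (subst prod_zero_iff, simp, rule notI)
    assume "\<exists>c\<in>{..<Suc a}. - ?r - x c = 0"
    then obtain c where "c < Suc a" "?r + x c = 0" by auto
    thus False using Suc.prems(1)[of c "Suc a"] by auto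
  qed
  moreover have "poly (?\<omega> (Suc a)) (- ?r) = (\<Prod>c<Suc a. - ?r - x c)"
    unfolding poly_prod by (intro prod.cong) auto
  ultimately have "poly (P - Polynomial.smult k (?\<omega> (Suc a))) (- ?r) = 0"
    unfolding poly_diff poly_smult k_def by simp
  hence "[:- (- ?r), 1:] dvd P - Polynomial.smult k (?\<omega> (Suc a))"
    by (simp only: poly_eq_0_iff_dvd)
  then obtain P' where "P - Polynomial.smult k (?\<omega> (Suc a)) = [:- (- ?r), 1:] * P'"
    by (rule dvdE)
  hence P': "P - Polynomial.smult k (?\<omega> (Suc a)) = [:?r, 1:] * P'"
    by (simp only: minus_minus)
  have deg_\<omega>: "degree (?\<omega> (Suc a)) \<le> Suc a"
    using degree_prod_sum_le[of "{..<Suc a}" "\<lambda>c. [:- x c, 1:]"] by simp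
  have "degree P' \<le> a"
  proof (cases "P' = 0")
    case False
    have "degree ([:?r, 1:] * P') \<le> Suc a"
      unfolding P'[symmetric] using Suc.prems(2) deg_\<omega>
      by (intro degree_diff_le order_trans[OF degree_smult_le]) auto
    moreover have "degree ([:?r, 1:] * P') = Suc (degree P')"
      using False by (subst degree_mult_eq) auto
    ultimately show ?thesis by simp
  qed simp
  with Suc.IH[of P'] Suc.prems(1) obtain \<kappa> where \<kappa>:
    "P' = (\<Sum>b\<le>a. Polynomial.smult (\<kappa> b) (?\<omega> b * (\<Prod>c\<in>{b<..a}. [:r c, 1:])))"
    by auto
  have step: "(\<Prod>c\<in>{b<..Suc a}. [:r c, 1:]) = [:?r, 1:] * (\<Prod>c\<in>{b<..a}. [:r c, 1:])" if "b \<le> a" for b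
  proof -
    have "{b<..Suc a} = insert (Suc a) {b<..a}" using that by auto
    thus ?thesis by simp
  qed
  let ?\<kappa> = "\<kappa>(Suc a := k)"
  have "P = Polynomial.smult k (?\<omega> (Suc a)) + [:?r, 1:] * P'"
    using P' by (simp add: algebra_simps)
  also have "[:?r, 1:] * P' = (\<Sum>b\<le>a. Polynomial.smult (\<kappa> b) (?\<omega> b * (\<Prod>c\<in>{b<..Suc a}. [:r c, 1:])))"
    unfolding \<kappa> sum_distrib_left
    by (intro sum.cong refl) (simp only: step atMost_iff mult_smult_right mult.left_commute)
  also have "\<dots> = (\<Sum>b\<le>a. Polynomial.smult (?\<kappa> b) (?\<omega> b * (\<Prod>c\<in>{b<..Suc a}. [:r c, 1:])))"
    by (intro sum.cong) auto
  finally have "P = (\<Sum>b\<le>Suc a. Polynomial.smult (?\<kappa> b) (?\<omega> b * (\<Prod>c\<in>{b<..Suc a}. [:r c, 1:])))"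
    by (simp add: add.commute)
  thus ?case by (intro exI[of _ ?\<kappa>]) (simp add: k_def)
qed

section \<open>Rational functions as power series at a node\<close>

text \<open>Reading a polynomial in \<open>z\<close> as a power series in \<open>t\<close> at \<open>z = \<xi> - t\<close>.\<close>

definition eval_fps_at :: "real \<Rightarrow> real poly \<Rightarrow> real fps" where
  "eval_fps_at \<xi> P = fps_of_poly (pcompose P [:\<xi>, -1:])"

lemma eval_fps_at_linear: "eval_fps_at \<xi> [:c, 1:] = fps_const (\<xi> + c) - fps_X"
  by (rule fps_ext) (auto simp: eval_fps_at_def pcompose_pCons coeff_pCons fps_of_poly_nth
      fps_X_def add.commute split: nat.splits)

lemma eval_fps_at_hom:
  "eval_fps_at \<xi> (P * Q) = eval_fps_at \<xi> P * eval_fps_at \<xi> Q"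
  "eval_fps_at \<xi> (prod f A) = (\<Prod>a\<in>A. eval_fps_at \<xi> (f a))"
  "eval_fps_at \<xi> (sum f A) = (\<Sum>a\<in>A. eval_fps_at \<xi> (f a))"
  "eval_fps_at \<xi> (Polynomial.smult c P) = fps_const c * eval_fps_at \<xi> P"
  "eval_fps_at \<xi> (P ^ k) = eval_fps_at \<xi> P ^ k"
proof -
  show *: "eval_fps_at \<xi> (P * Q) = eval_fps_at \<xi> P * eval_fps_at \<xi> Q" for P Q
    by (simp add: eval_fps_at_def pcompose_mult fps_of_poly_mult)
  show "eval_fps_at \<xi> (P ^ k) = eval_fps_at \<xi> P ^ k"
    by (induction k) (simp_all add: * , simp add: eval_fps_at_def pcompose_1)
qed (simp_all add: eval_fps_at_def pcompose_prod pcompose_sum pcompose_smult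
    fps_of_poly_prod fps_of_poly_sum fps_of_poly_smult)

text \<open>At \<open>z = \<xi> - t\<close> this is a rational function of \<open>z\<close> whose
  numerator vanishes at the first \<open>b\<close> nodes and whose denominator runs over the first
  \<open>b + 1\<close> rates, both with multiplicity.\<close>

definition newton_cauchy :: "(nat \<Rightarrow> real) \<Rightarrow> (nat \<Rightarrow> real) \<Rightarrow> nat \<Rightarrow> real \<Rightarrow> real fps" where
  "newton_cauchy x r b \<xi> =
     (\<Prod>c<b. fps_const (\<xi> - x c) - fps_X) * (\<Prod>c\<le>b. pole_fps (\<xi> + r c))"

text \<open>The polynomial expansion divided by all factors \<open>z + r c\<close> with
  \<open>c \<le> a\<close>; those with \<open>c > b\<close> cancel in summand \<open>b\<close>. The
  coefficients come from the polynomial identity, hence serve every \<open>\<xi>\<close>.\<close>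

lemma newton_cauchy_expansion_fps:
  assumes "\<And>b c. c < b \<Longrightarrow> b \<le> a \<Longrightarrow> r b + x c \<noteq> 0" "degree P \<le> a"
  shows "\<exists>\<kappa>. \<kappa> a = poly P (- r a) / (\<Prod>c<a. - r a - x c) \<and>
    (\<forall>\<xi>. (\<forall>c\<le>a. \<xi> + r c \<noteq> 0) \<longrightarrow> eval_fps_at \<xi> P * (\<Prod>c\<le>a. pole_fps (\<xi> + r c))
       = (\<Sum>b\<le>a. fps_const (\<kappa> b) * newton_cauchy x r b \<xi>))"
proof -
  obtain \<kappa> where \<kappa>: "\<kappa> a = poly P (- r a) / (\<Prod>c<a. - r a - x c)"
    "P = (\<Sum>b\<le>a. Polynomial.smult (\<kappa> b) ((\<Prod>c<b. [:- x c, 1:]) * (\<Prod>c\<in>{b<..a}. [:r c, 1:])))"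
    using newton_cauchy_expansion[of a r x P] assms by blast
  have "eval_fps_at \<xi> P * (\<Prod>c\<le>a. pole_fps (\<xi> + r c)) = (\<Sum>b\<le>a. fps_const (\<kappa> b) * newton_cauchy x r b \<xi>)"
    if nz: "\<forall>c\<le>a. \<xi> + r c \<noteq> 0" for \<xi>
  proof -
    have "eval_fps_at \<xi> P = (\<Sum>b\<le>a. fps_const (\<kappa> b) * ((\<Prod>c<b. fps_const (\<xi> - x c) - fps_X)
        * (\<Prod>c\<in>{b<..a}. fps_const (\<xi> + r c) - fps_X)))"
      by (subst \<kappa>(2)) (simp add: eval_fps_at_hom eval_fps_at_linear)
    hence "eval_fps_at \<xi> P * (\<Prod>c\<le>a. pole_fps (\<xi> + r c))
      = (\<Sum>b\<le>a. fps_const (\<kappa> b) * ((\<Prod>c<b. fps_const (\<xi> - x c) - fps_X)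
          * ((\<Prod>c\<in>{b<..a}. fps_const (\<xi> + r c) - fps_X) * (\<Prod>c\<le>a. pole_fps (\<xi> + r c)))))"
      by (simp only: sum_distrib_right mult.assoc)
    also have "\<dots> = (\<Sum>b\<le>a. fps_const (\<kappa> b) * newton_cauchy x r b \<xi>)"
    proof (intro sum.cong refl)
      fix b assume b: "b \<in> {..a}"
      have "{..a} = {b<..a} \<union> {..b}" using b by auto
      hence "(\<Prod>c\<le>a. pole_fps (\<xi> + r c)) = (\<Prod>c\<in>{b<..a}. pole_fps (\<xi> + r c)) * (\<Prod>c\<le>b. pole_fps (\<xi> + r c))"
        by (simp only:) (rule prod.union_disjoint, auto)
      hence "(\<Prod>c\<in>{b<..a}. fps_const (\<xi> + r c) - fps_X) * (\<Prod>c\<le>a. pole_fps (\<xi> + r c))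
          = ((\<Prod>c\<in>{b<..a}. fps_const (\<xi> + r c) - fps_X) * (\<Prod>c\<in>{b<..a}. pole_fps (\<xi> + r c)))
            * (\<Prod>c\<le>b. pole_fps (\<xi> + r c))"
        by (simp only: mult.assoc)
      also have "(\<Prod>c\<in>{b<..a}. fps_const (\<xi> + r c) - fps_X) * (\<Prod>c\<in>{b<..a}. pole_fps (\<xi> + r c)) = 1"
        unfolding prod.distrib[symmetric]
        using nz by (intro prod.neutral ballI inverse_mult_eq_1') auto
      finally show "fps_const (\<kappa> b) * ((\<Prod>c<b. fps_const (\<xi> - x c) - fps_X)
          * ((\<Prod>c\<in>{b<..a}. fps_const (\<xi> + r c) - fps_X) * (\<Prod>c\<le>a. pole_fps (\<xi> + r c))))
          = fps_const (\<kappa> b) * newton_cauchy x r b \<xi>"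
        by (simp add: newton_cauchy_def)
    qed
    finally show ?thesis .
  qed
  thus ?thesis using \<kappa>(1) by blast
qed

text \<open>The first \<open>a + 1\<close> rates are each \<open>\<rho> j\<close> with
  \<open>j < h\<close>, repeated \<open>m j\<close> times, followed by \<open>Suc s\<close> copies
  of \<open>\<rho> h\<close>. Taking for \<open>P\<close> the product over the complete blocks
  cancels all of them but the last group, so the quotient is the desired pole power.\<close>

lemma pole_power_expansion:
  fixes \<rho> x :: "nat \<Rightarrow> real" and m :: "nat \<Rightarrow> nat" and q :: nat
  defines "r \<equiv> \<lambda>a. \<rho> (fst (lex_pairs q m ! a))"
  assumes "h < q" "s < m h" and a: "a = (\<Sum>j<h. m j) + s"
    and nz: "\<And>b c. c < b \<Longrightarrow> b \<le> a \<Longrightarrow> r b + x c \<noteq> 0"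
  shows "\<exists>\<kappa>. \<kappa> a = (- 1) ^ s * (\<Prod>j<h. (\<rho> h - \<rho> j) ^ m j) / (\<Prod>c<a. r a + x c) \<and>
    (\<forall>\<xi>. (\<forall>j<q. \<xi> + \<rho> j \<noteq> 0) \<longrightarrow> pole_fps (\<xi> + \<rho> h) ^ Suc s
       = (\<Sum>b\<le>a. fps_const (\<kappa> b) * newton_cauchy x r b \<xi>))"
proof -
  define P where "P = (\<Prod>j<h. [:\<rho> j, 1:] ^ m j)"
  have r_a: "r a = \<rho> h"
    unfolding r_def a by (simp add: nth_lex_pairs assms)
  have "degree P \<le> (\<Sum>j<h. degree ([:\<rho> j, 1:] ^ m j))"
    unfolding P_def by (rule degree_prod_sum_le[unfolded o_def]) simp
  also have "\<dots> \<le> (\<Sum>j<h. m j)"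
    by (intro sum_mono order_trans[OF degree_power_le]) simp
  finally have "degree P \<le> a" using a by simp
  from newton_cauchy_expansion_fps[of a r x P] nz this obtain \<kappa> where
    \<kappa>: "\<kappa> a = poly P (- r a) / (\<Prod>c<a. - r a - x c)"
    "\<forall>\<xi>. (\<forall>c\<le>a. \<xi> + r c \<noteq> 0) \<longrightarrow> eval_fps_at \<xi> P * (\<Prod>c\<le>a. pole_fps (\<xi> + r c))
      = (\<Sum>b\<le>a. fps_const (\<kappa> b) * newton_cauchy x r b \<xi>)" by blast
  have "pole_fps (\<xi> + \<rho> h) ^ Suc s = (\<Sum>b\<le>a. fps_const (\<kappa> b) * newton_cauchy x r b \<xi>)"
    if nz: "\<forall>j<q. \<xi> + \<rho> j \<noteq> 0" for \<xi>
  proof -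
    have "(\<Sum>j<Suc h. m j) \<le> (\<Sum>j<q. m j)"
      using \<open>h < q\<close> by (intro sum_mono2) auto
    hence "c < (\<Sum>j<q. m j)" if "c \<le> a" for c
      using that a \<open>s < m h\<close> by simp
    hence "fst (lex_pairs q m ! c) < q" if "c \<le> a" for c
      using that by (metis fst_conv lex_pairs_indexE nth_lex_pairs)
    hence \<kappa>2: "eval_fps_at \<xi> P * (\<Prod>c\<le>a. pole_fps (\<xi> + r c)) = (\<Sum>b\<le>a. fps_const (\<kappa> b) * newton_cauchy x r b \<xi>)"
      using nz by (intro \<kappa>(2)[rule_format]) (auto simp: r_def)
    have "(\<Prod>c\<le>a. pole_fps (\<xi> + r c)) = (\<Prod>c<(\<Sum>j<h. m j) + Suc s. pole_fps (\<xi> + \<rho> (fst (lex_pairs q m ! c))))"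
      by (simp add: a r_def lessThan_Suc_atMost)
    also have "\<dots> = (\<Prod>j<h. pole_fps (\<xi> + \<rho> j) ^ m j) * pole_fps (\<xi> + \<rho> h) ^ Suc s"
      using assms by (intro prod_lex_pairs_prefix) auto
    finally have "eval_fps_at \<xi> P * (\<Prod>c\<le>a. pole_fps (\<xi> + r c))
      = (\<Prod>j<h. (fps_const (\<xi> + \<rho> j) - fps_X) ^ m j * pole_fps (\<xi> + \<rho> j) ^ m j) * pole_fps (\<xi> + \<rho> h) ^ Suc s"
      by (simp only: P_def eval_fps_at_hom eval_fps_at_linear prod.distrib mult.assoc)
    also have "(\<Prod>j<h. (fps_const (\<xi> + \<rho> j) - fps_X) ^ m j * pole_fps (\<xi> + \<rho> j) ^ m j) = 1"
      unfolding power_mult_distrib[symmetric] using nz \<open>h < q\<close>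
      by (intro prod.neutral ballI) (subst inverse_mult_eq_1', auto)
    finally show ?thesis using \<kappa>2 by simp
  qed
  moreover have "poly P (- r a) / (\<Prod>c<a. - r a - x c)
      = (- 1) ^ s * (\<Prod>j<h. (\<rho> h - \<rho> j) ^ m j) / (\<Prod>c<a. r a + x c)"
  proof -
    \<comment> \<open>Signs: the numerator carries one for each entry of the complete blocks, the
      denominator one for each of the \<open>a\<close> factors; the quotient keeps
      \<open>(- 1) ^ s\<close>.\<close>
    have "poly P (- r a) = (\<Prod>j<h. (- 1) ^ m j * (\<rho> h - \<rho> j) ^ m j)"
      unfolding P_def poly_prod r_a
      by (intro prod.cong refl) (simp add: flip: power_mult_distrib)
    also have "\<dots> = (- 1) ^ (\<Sum>j<h. m j) * (\<Prod>j<h. (\<rho> h - \<rho> j) ^ m j)"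
      by (simp add: prod.distrib power_sum)
    finally have "poly P (- r a) = (- 1) ^ (\<Sum>j<h. m j) * (\<Prod>j<h. (\<rho> h - \<rho> j) ^ m j)" .
    moreover have "(\<Prod>c<a. - r a - x c) = (\<Prod>c<a. (- 1) * (r a + x c))"
      by (intro prod.cong) auto
    hence "(\<Prod>c<a. - r a - x c) = (- 1) ^ a * (\<Prod>c<a. r a + x c)"
      by (simp only: prod.distrib) simp
    moreover have "(- 1) ^ a = (- 1 :: real) ^ (\<Sum>j<h. m j) * (- 1) ^ s"
      by (simp add: a power_add)
    moreover have "u * v / (u * w * y) = w * v / y" if "u \<in> {1, -1}" "w \<in> {1, -1}" for u v w y :: real
      using that by auto
    hence "(- 1) ^ A * v / ((- 1) ^ A * (- 1) ^ s * y) = (- 1) ^ s * v / y" for A and v y :: real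
      by (metis insertI1 insertI2 neg_one_even_power neg_one_odd_power)
    ultimately show ?thesis by presburger
  qed
  ultimately show ?thesis using \<kappa>(1) by (intro exI[of _ \<kappa>]) simp
qed

section \<open>Values of the basis at the nodes, and product identities\<close>

lemma fps_prod_nth_0: "fps_nth (prod f A) 0 = (\<Prod>a\<in>A. fps_nth (f a :: 'a :: comm_semiring_1 fps) 0)"
  by (induction A rule: infinite_finite_induct) simp_all

text \<open>At \<open>\<xi> i\<close> every factor whose node belongs to block \<open>i\<close>
  becomes \<open>- fps_X\<close>. Basis function \<open>b\<close> has \<open>l\<close> of them, so
  its coefficient of order \<open>l\<close> is a product of constant terms; any later one has at
  least \<open>l + 1\<close>, so that coefficient vanishes.\<close>

lemma newton_cauchy_nth:
  fixes \<xi> :: "nat \<Rightarrow> real" and n :: "nat \<Rightarrow> nat" and p :: nat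
  defines "x \<equiv> \<lambda>c. \<xi> (fst (lex_pairs p n ! c))"
  assumes "i < p" "l < n i" and b: "b = (\<Sum>r<i. n r) + l"
  shows "fps_nth (F * newton_cauchy x r b (\<xi> i)) l
      = (- 1) ^ l * fps_nth F 0 * (\<Prod>j<i. (\<xi> i - \<xi> j) ^ n j) / (\<Prod>c\<le>b. \<xi> i + r c)"
    and "b < a \<Longrightarrow> fps_nth (F * newton_cauchy x r a (\<xi> i)) l = 0"
proof -
  let ?f = "\<lambda>j. fps_const (\<xi> i - \<xi> j) - fps_X"
  have prefix: "(\<Prod>c<(\<Sum>r<i. n r) + s. fps_const (\<xi> i - x c) - fps_X) = (\<Prod>j<i. ?f j ^ n j) * (- fps_X) ^ s"
    if "s \<le> n i" for s
    using prod_lex_pairs_prefix[of i p s n ?f] assms that by (simp add: x_def)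
  have X: "(- fps_X) ^ s = fps_X ^ s * (- 1 :: real fps) ^ s" for s
    using power_mult_distrib[of fps_X "- 1 :: real fps" s] by simp
  define H where "H = (- 1) ^ l * F * (\<Prod>j<i. ?f j ^ n j) * (\<Prod>c\<le>b. pole_fps (\<xi> i + r c))"
  have "F * newton_cauchy x r b (\<xi> i) = fps_X ^ l * H"
    using prefix[of l] assms(3) by (simp add: newton_cauchy_def H_def b X mult_ac)
  hence "fps_nth (F * newton_cauchy x r b (\<xi> i)) l = fps_nth H 0"
    by (simp add: fps_X_power_mult_nth)
  also have "\<dots> = (- 1) ^ l * fps_nth F 0 * (\<Prod>j<i. (\<xi> i - \<xi> j) ^ n j) * (\<Prod>c\<le>b. inverse (\<xi> i + r c))"
    by (simp add: H_def fps_prod_nth_0 fps_nth_power_0)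
  finally show "fps_nth (F * newton_cauchy x r b (\<xi> i)) l
      = (- 1) ^ l * fps_nth F 0 * (\<Prod>j<i. (\<xi> i - \<xi> j) ^ n j) / (\<Prod>c\<le>b. \<xi> i + r c)"
    by (simp add: divide_inverse prod_inversef[unfolded o_def])
  assume "b < a"
  hence "(\<Prod>c<a. fps_const (\<xi> i - x c) - fps_X)
      = (\<Prod>c<Suc b. fps_const (\<xi> i - x c) - fps_X) * (\<Prod>c\<in>{Suc b..<a}. fps_const (\<xi> i - x c) - fps_X)"
    using prod.atLeastLessThan_concat[of 0 "Suc b" a "\<lambda>c. fps_const (\<xi> i - x c) - fps_X"]
    unfolding lessThan_atLeast0 by (metis Suc_leI le0)
  \<comment> \<open>Position \<open>b\<close> itself lies in block \<open>i\<close>, which supplies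
    the additional power of \<open>fps_X\<close>.\<close>
  also have "(\<Prod>c<Suc b. fps_const (\<xi> i - x c) - fps_X)
      = (\<Prod>j<i. ?f j ^ n j) * (- 1) ^ Suc l * fps_X ^ Suc l"
    using prefix[of "Suc l"] assms(3) unfolding X b by (simp only: Suc_leI add_Suc_right mult_ac)
  finally have "F * newton_cauchy x r a (\<xi> i) = fps_X ^ Suc l * ((\<Prod>j<i. ?f j ^ n j) * (- 1) ^ Suc l
      * (\<Prod>c\<in>{Suc b..<a}. fps_const (\<xi> i - x c) - fps_X) * (\<Prod>c\<le>a. pole_fps (\<xi> i + r c)) * F)"
    unfolding newton_cauchy_def by (simp only: mult_ac)
  thus "fps_nth (F * newton_cauchy x r a (\<xi> i)) l = 0"
    by (simp only: fps_X_power_mult_nth) simp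
qed

text \<open>The denominators of the two triangular factors run over the two halves of a square, with
  the diagonal in the second; together they give the full Cauchy product.\<close>

lemma prod_triangle_split:
  fixes f :: "nat \<Rightarrow> nat \<Rightarrow> 'a :: comm_monoid_mult"
  shows "(\<Prod>a<N. \<Prod>c<a. f c a) * (\<Prod>a<N. \<Prod>c\<le>a. f a c) = (\<Prod>a<N. \<Prod>c<N. f a c)"
proof (induction N)
  case (Suc N)
  have "(\<Prod>a<Suc N. \<Prod>c<a. f c a) * (\<Prod>a<Suc N. \<Prod>c\<le>a. f a c)
      = ((\<Prod>a<N. \<Prod>c<a. f c a) * (\<Prod>a<N. \<Prod>c\<le>a. f a c)) * (\<Prod>c<N. f c N) * (\<Prod>c<Suc N. f N c)"
    by (simp only: prod.lessThan_Suc[of _ N] mult_ac lessThan_Suc_atMost[of N, symmetric])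
  also have "\<dots> = (\<Prod>a<Suc N. \<Prod>c<Suc N. f a c)"
    unfolding Suc.IH by (simp only: prod.lessThan_Suc prod.distrib mult_ac)
  finally show ?case .
qed simp

lemma prod_neg_one_power: "(\<Prod>k<m. (- 1) ^ k) = (- 1 :: 'a :: comm_ring_1) ^ (m choose 2)"
proof (induction m)
  case (Suc m)
  have "Suc m choose 2 = (m choose 2) + m" by (simp add: numeral_2_eq_2)
  thus ?case using Suc by (simp add: power_add)
qed (simp add: numeral_2_eq_2)

lemma kernel_fps_nth_0: "fps_nth (kernel_fps c d) 0 = c powr - d"
  by (simp add: kernel_fps_def)

text \<open>Raising one shape parameter by one inserts one simple pole, so all rows share the factor
  \<open>G\<close> and differ only in that pole.\<close>

lemma prod_kernel_fps_shift:
  fixes q :: nat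
  assumes "j < q" "\<And>h. h < q \<Longrightarrow> \<xi> + \<rho> h > 0"
  shows "(\<Prod>h<q. kernel_fps (\<xi> + \<rho> h) (d h + (if h = j then 1 else 0)))
      = (\<Prod>h<q. kernel_fps (\<xi> + \<rho> h) (d h)) * pole_fps (\<xi> + \<rho> j)"
proof -
  have "(\<Prod>h<q. kernel_fps (\<xi> + \<rho> h) (d h + (if h = j then 1 else 0)))
      = kernel_fps (\<xi> + \<rho> j) (d j + 1) * (\<Prod>h\<in>{..<q} - {j}. kernel_fps (\<xi> + \<rho> h) (d h))"
    using assms(1) by (subst prod.remove[of "{..<q}" j]) (auto intro!: arg_cong2[where f = "(*)"] prod.cong)
  also have "\<dots> = kernel_fps (\<xi> + \<rho> j) (d j) * (\<Prod>h\<in>{..<q} - {j}. kernel_fps (\<xi> + \<rho> h) (d h))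
      * pole_fps (\<xi> + \<rho> j)"
    using assms by (simp only: kernel_fps_add_1 mult_ac)
  also have "kernel_fps (\<xi> + \<rho> j) (d j) * (\<Prod>h\<in>{..<q} - {j}. kernel_fps (\<xi> + \<rho> h) (d h))
      = (\<Prod>h<q. kernel_fps (\<xi> + \<rho> h) (d h))"
    using assms(1) by (subst prod.remove[of "{..<q}" j]) auto
  finally show ?thesis .
qed

section \<open>The determinant of the moment matrix\<close>

locale convolution_moments =
  fixes p q N :: nat and d \<rho> \<xi> :: "nat \<Rightarrow> real" and m n :: "nat \<Rightarrow> nat"
  assumes q_pos: "q \<ge> 1" and d_pos: "j < q \<Longrightarrow> d j > 0"
    and node_pos: "i < p \<Longrightarrow> j < q \<Longrightarrow> \<xi> i + \<rho> j > 0"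
    and sum_n: "(\<Sum>i<p. n i) = N" and sum_m: "(\<Sum>j<q. m j) = N"
    and near: "near_diagonal q m"
begin

definition "E i h = pole_fps (\<xi> i + \<rho> h)"
definition "G i = (\<Prod>h<q. kernel_fps (\<xi> i + \<rho> h) (d h))"
definition "r a = \<rho> (fst (lex_pairs q m ! a))"
definition "x b = \<xi> (fst (lex_pairs p n ! b))"

text \<open>Column \<open>(i, l)\<close> as a linear functional on families of series indexed by the
  nodes. By linearity, an expansion whose coefficients do not depend on the node becomes a product
  of matrices.\<close>

definition moment_col :: "nat \<Rightarrow> (nat \<Rightarrow> real fps) \<Rightarrow> real" where
  "moment_col b f = (case lex_pairs p n ! b of (i, l) \<Rightarrow> fact l * fps_nth (G i * f i) l)"

lemma row_indexE:
  assumes "a < N"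
  obtains j k where "j < q" "k < m j" "a = (\<Sum>h<j. m h) + k" "lex_pairs q m ! a = (j, k)"
  by (rule lex_pairs_indexE[of a m q])
    (use assms sum_m in simp, rule that, assumption+, simp add: nth_lex_pairs)

lemma col_indexE:
  assumes "b < N"
  obtains i l where "i < p" "l < n i" "b = (\<Sum>r<i. n r) + l" "lex_pairs p n ! b = (i, l)"
  by (rule lex_pairs_indexE[of b n p])
    (use assms sum_n in simp, rule that, assumption+, simp add: nth_lex_pairs)

lemma moment_col_sum:
  assumes "b < N" "\<And>i. i < p \<Longrightarrow> f i = (\<Sum>a\<in>A. fps_const (c a) * g a i)"
  shows "moment_col b f = (\<Sum>a\<in>A. c a * moment_col b (g a))"
proof -
  obtain i l where il: "i < p" "lex_pairs p n ! b = (i, l)" using col_indexE[OF assms(1)] by metis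
  have "G i * f i = (\<Sum>a\<in>A. fps_const (c a) * (G i * g a i))"
    using il by (simp add: assms(2) sum_distrib_left mult_ac)
  thus ?thesis by (simp add: moment_col_def il fps_sum_nth sum_distrib_left mult_ac)
qed

lemma M_LII_carrier: "M_LII p q d \<rho> \<xi> m n \<in> carrier_mat N N"
  by (simp add: M_LII_def sum_n sum_m)

lemma M_LII_entry:
  assumes "a < N" "b < N" "lex_pairs q m ! a = (j, k)" "j < q" "lex_pairs p n ! b = (i, l)"
  shows "M_LII p q d \<rho> \<xi> m n $$ (a, b) = fact l * fps_nth ((fps_deriv ^^ k) (G i * E i j)) l"
proof -
  have i: "i < p" using col_indexE[OF assms(2)] assms(5) by (metis prod.inject)
  have "M_LII p q d \<rho> \<xi> m n $$ (a, b)
      = (LINT y:{0<..}|lborel. y ^ (k + l) * row_fun q \<rho> d j y * exp (- \<xi> i * y))"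
    using assms by (simp add: M_LII_def sum_n sum_m)
  also have "\<dots> = fact (k + l)
      * fps_nth (\<Prod>h<q. kernel_fps (\<xi> i + \<rho> h) (d h + (if h = j then 1 else 0))) (k + l)"
    by (rule moment_row_fun) (use q_pos d_pos node_pos[OF i] in auto)
  also have "(\<Prod>h<q. kernel_fps (\<xi> i + \<rho> h) (d h + (if h = j then 1 else 0))) = G i * E i j"
    unfolding G_def E_def by (rule prod_kernel_fps_shift) (use assms(4) node_pos[OF i] in auto)
  finally have "M_LII p q d \<rho> \<xi> m n $$ (a, b) = fact (k + l) * fps_nth (G i * E i j) (k + l)" .
  thus ?thesis using fps_nth_funpow_deriv[of k "G i * E i j" l] by (simp add: mult.commute)
qed

text \<open>The form in which near-diagonality enters: for a row label \<open>(j, k)\<close>, every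
  \<open>(h, s)\<close> with \<open>h < q\<close> and \<open>s < k\<close> is a row label
  too.\<close>

lemma near_diagonal_le: "j < q \<Longrightarrow> h < q \<Longrightarrow> k < m j \<Longrightarrow> k \<le> m h"
  using near unfolding near_diagonal_def by fastforce

lemma deriv_expansion:
  assumes inj: "inj_on \<rho> {j. j < q \<and> m j > 0}" and jk: "j < q" "k < m j"
  shows "\<exists>c. \<forall>i<p. (fps_deriv ^^ k) (G i * E i j) =
    G i * (fps_const (pochhammer (d j + 1) k) * E i j ^ Suc k
      + (\<Sum>h<q. \<Sum>s<k. fps_const (c h s) * E i h ^ Suc s))"
\<comment> \<open>For \<open>k = 0\<close> nothing is differentiated. For \<open>k > 0\<close>
  near-diagonality makes every \<open>m h\<close> positive, so the injectivity assumption separates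
  all rates and partial fractions apply.\<close>
proof (cases "k = 0")
  case False
  have "0 < m h" if "h < q" for h
    using near_diagonal_le[OF jk(1) that jk(2)] False by simp
  hence inj': "\<rho> h \<noteq> \<rho> h'" if "h < q" "h' < q" "h \<noteq> h'" for h h'
    using that inj by (auto simp: inj_on_def)
  interpret pole_system "{..<p}" q E G d \<rho>
  proof
    fix i assume i: "i \<in> {..<p}"
    have nz: "\<xi> i + \<rho> h \<noteq> 0" if "h < q" for h using node_pos[of i h] i that by simp
    show "fps_deriv (E i h) = E i h ^ 2" if "h < q" for h
      using nz[OF that] by (simp add: E_def fps_deriv_pole_fps)
    show "fps_deriv (G i) = G i * (\<Sum>h<q. fps_const (d h) * E i h)"
      unfolding G_def E_def using i node_pos by (intro fps_deriv_prod_log kernel_fps_add_1) auto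
    fix h h' assume h: "h < q" "h' < q" "h \<noteq> h'"
    have "(\<xi> i + \<rho> h') - (\<xi> i + \<rho> h) = \<rho> h' - \<rho> h" by simp
    thus "E i h * E i h' = fps_const (1 / (\<rho> h' - \<rho> h)) * (E i h - E i h')"
      unfolding E_def using pole_fps_mult[OF nz nz, of h h'] h inj'[OF h] by simp
  qed
  show ?thesis using funpow_deriv_expansion[OF jk(1), of k] unfolding pole_span_def by auto
qed auto

section \<open>Factorisation into triangular matrices\<close>

definition U :: "real mat" where
  "U = Matrix.mat N N (\<lambda>(e, b). moment_col b (\<lambda>i. newton_cauchy x r e (\<xi> i)))"

lemma node_nonzero:
  assumes "a < N" "b < N"
  shows "r a + x b \<noteq> 0"
proof -
  obtain j k where "j < q" "lex_pairs q m ! a = (j, k)" using assms(1) by (rule row_indexE)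
  moreover obtain i l where "i < p" "lex_pairs p n ! b = (i, l)" using assms(2) by (rule col_indexE)
  ultimately show ?thesis using node_pos[of i j] by (simp add: r_def x_def)
qed

lemma U_entry:
  assumes "b < N" "lex_pairs p n ! b = (i, l)" "i < p" "l < n i" "b = (\<Sum>r<i. n r) + l"
  shows "U $$ (b, b) = (fact l * (- 1) ^ l * fps_nth (G i) 0 * (\<Prod>j<i. (\<xi> i - \<xi> j) ^ n j))
      / (\<Prod>c\<le>b. x b + r c)"
    and "b < a \<Longrightarrow> a < N \<Longrightarrow> U $$ (a, b) = 0"
proof -
  have x: "x = (\<lambda>c. \<xi> (fst (lex_pairs p n ! c)))" by (simp add: x_def fun_eq_iff)
  have "x b = \<xi> i" using assms by (simp add: x_def)
  thus "U $$ (b, b) = (fact l * (- 1) ^ l * fps_nth (G i) 0 * (\<Prod>j<i. (\<xi> i - \<xi> j) ^ n j))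
      / (\<Prod>c\<le>b. x b + r c)"
    using newton_cauchy_nth(1)[OF assms(3-5), of "G i" \<xi> r] assms
    by (simp add: U_def moment_col_def x)
  show "U $$ (a, b) = 0" if "b < a" "a < N"
    using newton_cauchy_nth(2)[OF assms(3-5) that(1), of "G i" \<xi> r] assms that
    by (simp add: U_def moment_col_def x)
qed

text \<open>\<open>T1\<close> passes from derivatives to pure pole powers and \<open>T2\<close> from
  pole powers to the Newton-Cauchy basis, on which the column functionals form
  \<open>U\<close>.\<close>

lemma factorization:
  assumes inj: "inj_on \<rho> {j. j < q \<and> m j > 0}"
  obtains T1 T2 where "T1 \<in> carrier_mat N N" "T2 \<in> carrier_mat N N"
    "M_LII p q d \<rho> \<xi> m n = T1 * (T2 * U)"
    "Determinant.det T1 = (\<Prod>j<q. \<Prod>k<m j. pochhammer (d j + 1) k)"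
    "Determinant.det T2 = (\<Prod>a<N. case lex_pairs q m ! a of (h, s) \<Rightarrow>
       (- 1) ^ s * (\<Prod>j<h. (\<rho> h - \<rho> j) ^ m j) / (\<Prod>c<a. r a + x c))"
proof -
  \<comment> \<open>The quantifier over \<open>i\<close> stays inside, so one family of coefficients
    serves all columns.\<close>
  have "\<forall>j k. \<exists>c. j < q \<and> k < m j \<longrightarrow> (\<forall>i<p. (fps_deriv ^^ k) (G i * E i j) =
    G i * (fps_const (pochhammer (d j + 1) k) * E i j ^ Suc k
      + (\<Sum>h<q. \<Sum>s<k. fps_const (c h s) * E i h ^ Suc s)))"
    using deriv_expansion[OF inj] by blast
  from this[unfolded choice_iff] obtain C where C: "\<And>j k i. j < q \<Longrightarrow> k < m j \<Longrightarrow> i < p \<Longrightarrow> (fps_deriv ^^ k) (G i * E i j) =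
    G i * (fps_const (pochhammer (d j + 1) k) * E i j ^ Suc k
      + (\<Sum>h<q. \<Sum>s<k. fps_const (C j k h s) * E i h ^ Suc s))"
    by blast
  let ?S = "SIGMA j:{..<q}. {..<m j}"
  define t :: "nat \<times> nat \<Rightarrow> nat \<times> nat \<Rightarrow> real" where
    "t y z = (if z = y then pochhammer (d (fst y) + 1) (snd y) else 0)
       + (if snd z < snd y then C (fst y) (snd y) (fst z) (snd z) else 0)" for y z
  have sum_t: "(\<Sum>z\<in>?S. fps_const (t (j, k) z) * f z) = fps_const (pochhammer (d j + 1) k) * f (j, k)
      + (\<Sum>h<q. \<Sum>s<k. fps_const (C j k h s) * f (h, s))" if jk: "j < q" "k < m j" for j k f
  proof -
    \<comment> \<open>By near-diagonality the whole rectangle of lower-order poles lies among the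
      row labels; otherwise the expansion would leave the span of the rows of
      \<open>W\<close>.\<close>
    have "{z \<in> ?S. snd z < k} = {..<q} \<times> {..<k}"
      using near_diagonal_le[OF jk(1) _ jk(2)] by force
    hence "(\<Sum>z\<in>?S. if snd z < k then fps_const (C j k (fst z) (snd z)) * f z else 0)
        = (\<Sum>h<q. \<Sum>s<k. fps_const (C j k h s) * f (h, s))"
      by (simp add: sum.inter_filter[symmetric] sum.cartesian_product case_prod_unfold)
    moreover have "(\<Sum>z\<in>?S. if z = (j, k) then fps_const (pochhammer (d j + 1) k) * f z else 0)
        = fps_const (pochhammer (d j + 1) k) * f (j, k)"
      using jk by simp
    moreover have "fps_const (t (j, k) z) * f z = (if z = (j, k) then fps_const (pochhammer (d j + 1) k) * f z else 0)
       + (if snd z < k then fps_const (C j k (fst z) (snd z)) * f z else 0)" for z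
      by (auto simp: t_def)
    ultimately show ?thesis by (simp only: sum.distrib)
  qed
  \<comment> \<open>The confluent Cauchy matrix, weighted by \<open>G\<close>.\<close>
  define W where "W = Matrix.mat N N (\<lambda>(c, b). case lex_pairs q m ! c of (h, s) \<Rightarrow> moment_col b (\<lambda>i. E i h ^ Suc s))"
  define T1 where "T1 = Matrix.mat N N (\<lambda>(a, c). t (lex_pairs q m ! a) (lex_pairs q m ! c))"
  have T1: "T1 \<in> carrier_mat N N" and W: "W \<in> carrier_mat N N" by (simp_all add: T1_def W_def)
  have "M_LII p q d \<rho> \<xi> m n = T1 * W"
  proof (rule eq_matI)
    fix a b assume "a < dim_row (T1 * W)" "b < dim_col (T1 * W)"
    hence ab: "a < N" "b < N" by (simp_all add: T1_def W_def)
    obtain j k where jk: "j < q" "k < m j" "lex_pairs q m ! a = (j, k)" using row_indexE[OF ab(1)] by metis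
    obtain i l where il: "i < p" "lex_pairs p n ! b = (i, l)" using col_indexE[OF ab(2)] by metis
    let ?w = "\<lambda>z. moment_col b (\<lambda>i. E i (fst z) ^ Suc (snd z))"
    have "M_LII p q d \<rho> \<xi> m n $$ (a, b) = moment_col b (\<lambda>i. fps_const (pochhammer (d j + 1) k) * E i j ^ Suc k
      + (\<Sum>h<q. \<Sum>s<k. fps_const (C j k h s) * E i h ^ Suc s))"
      using M_LII_entry[OF ab jk(3,1) il(2)] C[OF jk(1,2) il(1)] il by (simp add: moment_col_def)
    also have "\<dots> = (\<Sum>z\<in>?S. t (j, k) z * ?w z)"
      using sum_t[OF jk(1,2), of "\<lambda>z. E _ (fst z) ^ Suc (snd z)"] by (intro moment_col_sum[OF ab(2)]) simp
    also have "\<dots> = (\<Sum>c<N. t (j, k) (lex_pairs q m ! c) * ?w (lex_pairs q m ! c))"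
      using sum.reindex_bij_betw[OF bij_betw_lex_pairs, of "\<lambda>z. t (j, k) z * ?w z" q m] by (simp add: sum_m)
    also have "\<dots> = (T1 * W) $$ (a, b)"
      using ab jk by (simp add: T1_def W_def scalar_prod_def case_prod_unfold lessThan_atLeast0)
    finally show "M_LII p q d \<rho> \<xi> m n $$ (a, b) = (T1 * W) $$ (a, b)" .
  qed (use M_LII_carrier in \<open>auto simp: T1_def W_def\<close>)
  have "Determinant.det T1 = (\<Prod>a<N. T1 $$ (a, a))"
  \<comment> \<open>Lower-order poles of later blocks also occur, so \<open>T1\<close> need not be
    triangular in lexicographic order; the rank is the derivative order instead.\<close>
  proof (rule det_rank_triangular[OF T1, of "\<lambda>a. snd (lex_pairs q m ! a)"])
    fix a c assume "a < N" "c < N" "a \<noteq> c" "T1 $$ (a, c) \<noteq> 0"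
    moreover from this have "lex_pairs q m ! a \<noteq> lex_pairs q m ! c"
      using nth_eq_iff_index_eq[OF distinct_lex_pairs] by (simp add: length_lex_pairs sum_m)
    ultimately show "snd (lex_pairs q m ! c) < snd (lex_pairs q m ! a)"
      by (auto simp: T1_def t_def split: if_splits)
  qed
  also have "\<dots> = (\<Prod>a<N. t (lex_pairs q m ! a) (lex_pairs q m ! a))"
    by (simp add: T1_def)
  also have "\<dots> = (\<Prod>j<q. \<Prod>k<m j. pochhammer (d j + 1) k)"
    using prod_lex_pairs[of "\<lambda>z. t z z" q m] by (simp add: sum_m t_def)
  finally have det_T1: "Determinant.det T1 = (\<Prod>j<q. \<Prod>k<m j. pochhammer (d j + 1) k)" .
  let ?diag = "\<lambda>a. case lex_pairs q m ! a of (h, s) \<Rightarrow>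
       (- 1) ^ s * (\<Prod>j<h. (\<rho> h - \<rho> j) ^ m j) / (\<Prod>c<a. r a + x c)"
  have "\<forall>a. \<exists>\<kappa>. a < N \<longrightarrow> \<kappa> a = ?diag a \<and>
      (\<forall>i<p. case lex_pairs q m ! a of (h, s) \<Rightarrow>
        E i h ^ Suc s = (\<Sum>b\<le>a. fps_const (\<kappa> b) * newton_cauchy x r b (\<xi> i)))"
  proof (intro allI)
    fix a
    show "\<exists>\<kappa>. a < N \<longrightarrow> \<kappa> a = ?diag a \<and>
      (\<forall>i<p. case lex_pairs q m ! a of (h, s) \<Rightarrow>
        E i h ^ Suc s = (\<Sum>b\<le>a. fps_const (\<kappa> b) * newton_cauchy x r b (\<xi> i)))"
    proof (cases "a < N")
      case True
      from row_indexE[OF this] obtain h s where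
        hs: "h < q" "s < m h" "a = (\<Sum>j<h. m j) + s" "lex_pairs q m ! a = (h, s)" by metis
      have r: "r = (\<lambda>a. \<rho> (fst (lex_pairs q m ! a)))" by (simp add: r_def fun_eq_iff)
      have nz: "r b + x c \<noteq> 0" if "c < b" "b \<le> a" for b c using that True by (intro node_nonzero) auto
      have nz': "\<forall>j<q. \<xi> i + \<rho> j \<noteq> 0" if "i < p" for i using node_pos[OF that] by force
      show ?thesis
        using pole_power_expansion[of h q s m a \<rho> x, OF hs(1-3)] nz nz' hs(4) unfolding E_def r by auto
    qed simp
  qed
  from this[unfolded choice_iff] obtain \<kappa> where \<kappa>: "\<forall>a. a < N \<longrightarrow> \<kappa> a a = ?diag a \<and>
      (\<forall>i<p. case lex_pairs q m ! a of (h, s) \<Rightarrow>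
        E i h ^ Suc s = (\<Sum>b\<le>a. fps_const (\<kappa> a b) * newton_cauchy x r b (\<xi> i)))" ..
  define T2 where "T2 = Matrix.mat N N (\<lambda>(a, b). if b \<le> a then \<kappa> a b else 0)"
  have T2: "T2 \<in> carrier_mat N N" by (simp add: T2_def)
  have "W = T2 * U"
  proof (rule eq_matI)
    fix a b assume "a < dim_row (T2 * U)" "b < dim_col (T2 * U)"
    hence ab: "a < N" "b < N" by (simp_all add: T2_def U_def)
    obtain h s where hs: "lex_pairs q m ! a = (h, s)" by fastforce
    have E: "E i h ^ Suc s = (\<Sum>b\<le>a. fps_const (\<kappa> a b) * newton_cauchy x r b (\<xi> i))" if "i < p" for i
      using \<kappa>[rule_format, OF ab(1)] hs that by (simp del: power_Suc)
    have "W $$ (a, b) = moment_col b (\<lambda>i. E i h ^ Suc s)"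
      using ab hs by (simp add: W_def)
    also have "\<dots> = (\<Sum>e\<le>a. \<kappa> a e * moment_col b (\<lambda>i. newton_cauchy x r e (\<xi> i)))"
      by (intro moment_col_sum[OF ab(2)] E)
    also have "\<dots> = (\<Sum>e<N. (if e \<le> a then \<kappa> a e else 0) * moment_col b (\<lambda>i. newton_cauchy x r e (\<xi> i)))"
      using ab by (intro sum.mono_neutral_cong_left) auto
    also have "\<dots> = (T2 * U) $$ (a, b)"
      using ab by (simp add: T2_def U_def scalar_prod_def lessThan_atLeast0)
    finally show "W $$ (a, b) = (T2 * U) $$ (a, b)" .
  qed (auto simp: T2_def U_def W_def)
  moreover have "Determinant.det T2 = (\<Prod>a<N. T2 $$ (a, a))"
    by (rule det_rank_triangular[OF T2, of id]) (auto simp: T2_def split: if_splits)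
  hence "Determinant.det T2 = (\<Prod>a<N. ?diag a)"
    by (simp add: T2_def \<kappa>)
  ultimately show ?thesis
    using that[OF T1 T2] \<open>M_LII p q d \<rho> \<xi> m n = T1 * W\<close> det_T1 by simp
qed

lemma det_U:
  "Determinant.det U = (\<Prod>i<p. \<Prod>l<n i. fact l * (- 1) ^ l * fps_nth (G i) 0 * (\<Prod>j<i. (\<xi> i - \<xi> j) ^ n j))
     / (\<Prod>b<N. \<Prod>c\<le>b. x b + r c)"
proof -
  let ?u = "\<lambda>z. fact (snd z) * (- 1) ^ snd z * fps_nth (G (fst z)) 0 * (\<Prod>j<fst z. (\<xi> (fst z) - \<xi> j) ^ n j)"
  have "Determinant.det U = (\<Prod>b<N. U $$ (b, b))"
  \<comment> \<open>\<open>U\<close> is upper triangular, hence the rank that decreases with the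
    index.\<close>
  proof (rule det_rank_triangular[of _ _ "\<lambda>b. N - b"])
    fix a b assume ab: "a < N" "b < N" "a \<noteq> b" "U $$ (a, b) \<noteq> 0"
    obtain i l where "i < p" "l < n i" "b = (\<Sum>r<i. n r) + l" "lex_pairs p n ! b = (i, l)"
      using ab(2) by (rule col_indexE)
    hence "\<not> b < a" using U_entry(2) ab by blast
    thus "N - b < N - a" using ab by linarith
  qed (simp add: U_def)
  also have "\<dots> = (\<Prod>b<N. ?u (lex_pairs p n ! b) / (\<Prod>c\<le>b. x b + r c))"
  proof (intro prod.cong refl)
    fix b assume b: "b \<in> {..<N}"
    obtain i l where "i < p" "l < n i" "b = (\<Sum>r<i. n r) + l" "lex_pairs p n ! b = (i, l)"
      using b by (auto elim: col_indexE)
    thus "U $$ (b, b) = ?u (lex_pairs p n ! b) / (\<Prod>c\<le>b. x b + r c)"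
      using b U_entry(1)[of b i l] by simp
  qed
  finally show ?thesis
    using prod_lex_pairs[of ?u p n] by (simp add: prod_dividef sum_n)
qed

text \<open>Grouping the full Cauchy product by blocks gives \<open>\<xi> i + \<rho> j\<close> the
  exponent \<open>m j * n i\<close>; the constant terms of \<open>G\<close> contribute
  \<open>d j * n i\<close> to the same negative exponent.\<close>

lemma prod_G_div:
  "(\<Prod>i<p. fps_nth (G i) 0 ^ n i) / (\<Prod>b<N. \<Prod>c<N. x b + r c)
    = (\<Prod>i<p. \<Prod>j<q. (\<xi> i + \<rho> j) powr (- ((d j + real (m j)) * real (n i))))"
proof -
  have inner: "(\<Prod>c<N. y + r c) = (\<Prod>j<q. (y + \<rho> j) ^ m j)" for y
    using prod_lex_pairs[of "\<lambda>z. y + \<rho> (fst z)" q m] by (simp add: r_def sum_m)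
  have "(\<Prod>b<N. \<Prod>c<N. x b + r c) = (\<Prod>i<p. (\<Prod>j<q. (\<xi> i + \<rho> j) ^ m j) ^ n i)"
    unfolding inner using prod_lex_pairs[of "\<lambda>z. \<Prod>j<q. (\<xi> (fst z) + \<rho> j) ^ m j" p n]
    by (simp add: x_def sum_n)
  hence "(\<Prod>i<p. fps_nth (G i) 0 ^ n i) / (\<Prod>b<N. \<Prod>c<N. x b + r c)
      = (\<Prod>i<p. \<Prod>j<q. (((\<xi> i + \<rho> j) powr - d j) / (\<xi> i + \<rho> j) ^ m j) ^ n i)"
    by (simp only: G_def fps_prod_nth_0 kernel_fps_nth_0 prod_dividef prod_power_distrib power_divide)
  also have "\<dots> = (\<Prod>i<p. \<Prod>j<q. (\<xi> i + \<rho> j) powr (- ((d j + real (m j)) * real (n i))))"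
  proof (intro prod.cong refl)
    fix i j assume "i \<in> {..<p}" "j \<in> {..<q}"
    hence pos: "\<xi> i + \<rho> j > 0" using node_pos by simp
    have "(\<xi> i + \<rho> j) powr - d j / (\<xi> i + \<rho> j) ^ m j = (\<xi> i + \<rho> j) powr (- d j - real (m j))"
      using pos by (simp add: powr_diff powr_realpow)
    thus "((\<xi> i + \<rho> j) powr - d j / (\<xi> i + \<rho> j) ^ m j) ^ n i
        = (\<xi> i + \<rho> j) powr (- ((d j + real (m j)) * real (n i)))"
      using pos by (simp add: powr_power algebra_simps)
  qed
  finally show ?thesis .
qed

section \<open>The closed form, colliding rates, and nonvanishing\<close>

definition det_value :: real where
  "det_value = (- 1) ^ ((\<Sum>j<q. m j choose 2) + (\<Sum>i<p. n i choose 2))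
      * (\<Prod>j<q. \<Prod>k<m j. pochhammer (d j + 1) k)
      * (\<Prod>h<q. \<Prod>j<h. (\<rho> h - \<rho> j) ^ (m j * m h))
      * (\<Prod>i<p. \<Prod>l<n i. fact l)
      * (\<Prod>r<p. \<Prod>i<r. (\<xi> r - \<xi> i) ^ (n i * n r))
      * (\<Prod>i<p. \<Prod>j<q. (\<xi> i + \<rho> j) powr (- ((d j + real (m j)) * real (n i))))"

lemma det_M_LII_distinct:
  assumes inj: "inj_on \<rho> {j. j < q \<and> m j > 0}"
  shows "Determinant.det (M_LII p q d \<rho> \<xi> m n) = det_value"
proof -
  have U: "U \<in> carrier_mat N N" by (simp add: U_def)
  obtain T1 T2 where T: "T1 \<in> carrier_mat N N" "T2 \<in> carrier_mat N N"
    "M_LII p q d \<rho> \<xi> m n = T1 * (T2 * U)"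
    "Determinant.det T1 = (\<Prod>j<q. \<Prod>k<m j. pochhammer (d j + 1) k)"
    "Determinant.det T2 = (\<Prod>a<N. case lex_pairs q m ! a of (h, s) \<Rightarrow>
       (- 1) ^ s * (\<Prod>j<h. (\<rho> h - \<rho> j) ^ m j) / (\<Prod>c<a. r a + x c))"
    by (rule factorization[OF inj])
  have sign: "(\<Prod>j<a. \<Prod>k<f j. (- 1 :: real) ^ k) = (- 1) ^ (\<Sum>j<a. f j choose 2)" for f a
    by (simp add: prod_neg_one_power power_sum)
  have vand: "(\<Prod>h<a. (\<Prod>j<h. (y h - y j) ^ f j) ^ f h) = (\<Prod>h<a. \<Prod>j<h. (y h - y j) ^ (f j * f h))"
    for y :: "nat \<Rightarrow> real" and f and a :: nat
    by (simp add: prod_power_distrib power_mult)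
  \<comment> \<open>The denominator is written as \<open>x c + r a\<close> to match the strict half
    of the square in \<open>prod_triangle_split\<close>.\<close>
  have "Determinant.det T2 = (\<Prod>h<q. \<Prod>s<m h. (- 1) ^ s * (\<Prod>j<h. (\<rho> h - \<rho> j) ^ m j))
      / (\<Prod>a<N. \<Prod>c<a. x c + r a)"
    using prod_lex_pairs[of "\<lambda>(h, s). (- 1) ^ s * (\<Prod>j<h. (\<rho> h - \<rho> j) ^ m j)" q m]
    by (simp add: T(5) sum_m case_prod_unfold prod_dividef add.commute)
  also have "(\<Prod>h<q. \<Prod>s<m h. (- 1) ^ s * (\<Prod>j<h. (\<rho> h - \<rho> j) ^ m j))
      = (- 1) ^ (\<Sum>j<q. m j choose 2) * (\<Prod>h<q. \<Prod>j<h. (\<rho> h - \<rho> j) ^ (m j * m h))"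
    by (simp only: prod.distrib sign prod_constant card_lessThan vand)
  finally have T2: "Determinant.det T2 = (- 1) ^ (\<Sum>j<q. m j choose 2)
      * (\<Prod>h<q. \<Prod>j<h. (\<rho> h - \<rho> j) ^ (m j * m h)) / (\<Prod>a<N. \<Prod>c<a. x c + r a)" .
  have "(\<Prod>i<p. \<Prod>l<n i. fact l * (- 1) ^ l * fps_nth (G i) 0 * (\<Prod>j<i. (\<xi> i - \<xi> j) ^ n j))
      = (\<Prod>i<p. \<Prod>l<n i. fact l) * (- 1) ^ (\<Sum>i<p. n i choose 2) * (\<Prod>i<p. fps_nth (G i) 0 ^ n i)
        * (\<Prod>r<p. \<Prod>i<r. (\<xi> r - \<xi> i) ^ (n i * n r))"
    by (simp only: prod.distrib sign prod_constant card_lessThan vand)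
  note U' = det_U[unfolded this]
  have "Determinant.det (M_LII p q d \<rho> \<xi> m n) = Determinant.det T1 * (Determinant.det T2 * Determinant.det U)"
    using T(1,2) U by (simp add: T(3) det_mult[of _ N])
  also have "\<dots> = (\<Prod>j<q. \<Prod>k<m j. pochhammer (d j + 1) k)
      * ((- 1) ^ (\<Sum>j<q. m j choose 2) * (- 1) ^ (\<Sum>i<p. n i choose 2))
      * (\<Prod>h<q. \<Prod>j<h. (\<rho> h - \<rho> j) ^ (m j * m h)) * (\<Prod>i<p. \<Prod>l<n i. fact l)
      * (\<Prod>r<p. \<Prod>i<r. (\<xi> r - \<xi> i) ^ (n i * n r))
      * ((\<Prod>i<p. fps_nth (G i) 0 ^ n i)
        / ((\<Prod>a<N. \<Prod>c<a. x c + r a) * (\<Prod>b<N. \<Prod>c\<le>b. x b + r c)))"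
    unfolding T(4) T2 U' by simp
  also have "\<dots> = det_value"
    unfolding prod_triangle_split prod_G_div det_value_def power_add by (simp only: mult_ac)
  finally show ?thesis .
qed

lemma det_M_LII_collision:
  assumes "\<not> inj_on \<rho> {j. j < q \<and> m j > 0}"
  shows "Determinant.det (M_LII p q d \<rho> \<xi> m n) = det_value"
proof -
  obtain j h where "j < q" "h < q" "m j > 0" "m h > 0" "\<rho> j = \<rho> h" "j \<noteq> h"
    using assms by (auto simp: inj_on_def)
  then obtain j h where jh: "j < h" "h < q" "m j > 0" "m h > 0" "\<rho> j = \<rho> h"
    by (metis nat_neq_iff)
  hence j: "j < q" by simp
  \<comment> \<open>\<open>a i\<close> is the position of the label \<open>(i, 0)\<close>, present
    whenever \<open>m i > 0\<close>. The two colliding rows are compared at derivative order 0,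
    where they depend on the block only through its rate.\<close>
  define a where "a = (\<lambda>j. \<Sum>i<j. m i)"
  have a: "lex_pairs q m ! a i = (i, 0)" "a i < N" if "i < q" "m i > 0" for i
  proof -
    show "lex_pairs q m ! a i = (i, 0)" using nth_lex_pairs[of i q 0 m] that by (simp add: a_def)
    have "(\<Sum>j<Suc i. m j) \<le> N"
      unfolding sum_m[symmetric] using that by (intro sum_mono2) auto
    thus "a i < N" using that by (simp add: a_def)
  qed
  have "row (M_LII p q d \<rho> \<xi> m n) (a j) = row (M_LII p q d \<rho> \<xi> m n) (a h)"
  proof (rule eq_vecI)
    fix b assume "b < dim_vec (row (M_LII p q d \<rho> \<xi> m n) (a h))"
    hence b: "b < N" using M_LII_carrier by simp
    obtain i l where il: "lex_pairs p n ! b = (i, l)" by fastforce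
    have "M_LII p q d \<rho> \<xi> m n $$ (a j, b) = M_LII p q d \<rho> \<xi> m n $$ (a h, b)"
      using M_LII_entry[OF a(2) b a(1) _ il] jh j by (simp add: E_def)
    thus "vec_index (row (M_LII p q d \<rho> \<xi> m n) (a j)) b = vec_index (row (M_LII p q d \<rho> \<xi> m n) (a h)) b"
      using M_LII_carrier b by (simp add: Matrix.row_def)
  qed (use M_LII_carrier in simp)
  moreover have "a j \<noteq> a h" using a(1)[of j] a(1)[of h] jh j by auto
  ultimately have "Determinant.det (M_LII p q d \<rho> \<xi> m n) = 0"
    using det_identical_rows[OF M_LII_carrier] a(2) jh j by blast
  moreover have "(\<Prod>h<q. \<Prod>j<h. (\<rho> h - \<rho> j) ^ (m j * m h)) = 0"
    using jh by (intro prod_zero bexI[of _ h] bexI[of _ j]) auto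
  ultimately show ?thesis by (simp add: det_value_def)
qed

lemma det_value_nonzero:
  assumes "inj_on \<rho> {j. j < q \<and> m j > 0}" "inj_on \<xi> {i. i < p \<and> n i > 0}"
  shows "det_value \<noteq> 0"
proof -
  have vand: "(\<Prod>h<a. \<Prod>j<h. (y h - y j) ^ (f j * f h)) \<noteq> 0"
    if "inj_on y {j. j < a \<and> f j > 0}" for y :: "nat \<Rightarrow> real" and f :: "nat \<Rightarrow> nat" and a :: nat
  proof -
    \<comment> \<open>If one of the multiplicities is zero the exponent is zero and the power is 1,
      so only points of positive multiplicity have to be distinct.\<close>
    have "(y h - y j) ^ (f j * f h) \<noteq> 0" if "h < a" "j < h" for h j
      using that \<open>inj_on y _\<close> by (cases "f j = 0 \<or> f h = 0") (auto dest: inj_onD)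
    thus ?thesis by simp
  qed
  have "pochhammer (d j + 1) k > 0" if "j < q" for j k
    using d_pos[OF that] by (intro pochhammer_pos) simp
  hence "(\<Prod>j<q. \<Prod>k<m j. pochhammer (d j + 1) k) \<noteq> 0"
    by (metis (no_types, lifting) finite_lessThan lessThan_iff less_irrefl prod_zero_iff)
  moreover have "\<xi> i + \<rho> j \<noteq> 0" if "i < p" "j < q" for i j
    using node_pos[OF that] by simp
  ultimately show ?thesis
    using vand[OF assms(1)] vand[OF assms(2)] by (simp add: det_value_def)
qed

end

theorem theorem4p7:
  fixes p q N :: nat
    and d \<rho> \<xi> :: "nat \<Rightarrow> real"
    and m n :: "nat \<Rightarrow> nat"
  assumes "p \<ge> 1" and "q \<ge> 1"
    and "\<And>j. j < q \<Longrightarrow> d j > 0"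
    and "\<And>j. j < q \<Longrightarrow> \<rho> j > 0"
    and "\<And>i j. i < p \<Longrightarrow> j < q \<Longrightarrow> \<xi> i + \<rho> j > 0"
    and "(\<Sum>i<p. n i) = N" and "(\<Sum>j<q. m j) = N"
    and "near_diagonal q m"
  shows "Determinant.det (M_LII p q d \<rho> \<xi> m n) =
      (- 1) ^ ((\<Sum>j<q. m j choose 2) + (\<Sum>i<p. n i choose 2))
      * (\<Prod>j<q. \<Prod>k<m j. pochhammer (d j + 1) k)
      * (\<Prod>h<q. \<Prod>j<h. (\<rho> h - \<rho> j) ^ (m j * m h))
      * (\<Prod>i<p. \<Prod>l<n i. fact l)
      * (\<Prod>r<p. \<Prod>i<r. (\<xi> r - \<xi> i) ^ (n i * n r))
      * (\<Prod>i<p. \<Prod>j<q. (\<xi> i + \<rho> j) powr (- ((d j + real (m j)) * real (n i))))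
    \<and> (inj_on \<rho> {j. j < q \<and> m j > 0} \<longrightarrow> inj_on \<xi> {i. i < p \<and> n i > 0} \<longrightarrow>
         Determinant.det (M_LII p q d \<rho> \<xi> m n) \<noteq> 0)"
proof -
  interpret convolution_moments p q N d \<rho> \<xi> m n
    by unfold_locales (use assms in auto)
  have det: "Determinant.det (M_LII p q d \<rho> \<xi> m n) = det_value"
    using det_M_LII_distinct det_M_LII_collision by blast
  show ?thesis
  proof (intro conjI impI)
    show "Determinant.det (M_LII p q d \<rho> \<xi> m n) \<noteq> 0"
      if "inj_on \<rho> {j. j < q \<and> m j > 0}" "inj_on \<xi> {i. i < p \<and> n i > 0}"
      unfolding det using that by (rule det_value_nonzero)
  qed (rule det[unfolded det_value_def])
qed

end
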